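(* For $\kappa\in L^\infty([0,\infty)\times\mathbb{Z})$ and $u_0\in\ell^1(\mathbb{Z})$, let $u:[0,\infty)\times\mathbb{Z}\to\mathbb{R}$ be a solution of $$\frac{\partial}{\partial t}u(t,y)=\tfrac12\Delta_d u(t,y)-\kappa(t,y)u(t,y),\quad t>0,\ y\in\mathbb{Z},\qquad u(0,y)=u_0(y),\quad y\in\mathbb{Z}.$$ Then, for all $0\le s\le t$, $$\Sigma(u(t,\cdot))\le\Sigma(u(s,\cdot)).$$ Moreover, in the special case $\Sigma(u_0)=1$, if $u_0$ satisfies $$\{y\in\mathbb{Z}:u_0(y)<0\}=\{y\in\mathbb{Z}:y\le a_0\}\quad\text{and}\quad\{y\in\mathbb{Z}:u_0(y)>0\}=\{y\in\mathbb{Z}:y\ge b_0\}$$ for some $a_0<b_0$ in $\mathbb{Z}$, then, for all $t\ge0$, the same property is satisfied by $u(t,\cdot)$ for some $a_t<b_t$ in $\mathbb{Z}\cup\{-\infty,\infty\}$, that is, $$\{y\in\mathbb{Z}:u(t,y)<0\}=\{y\in\mathbb{Z}:y\le a_t\}\quad\text{and}\quad\{y\in\mathbb{Z}:u(t,y)>0\}=\{y\in\mathbb{Z}:y\ge b_t\}.$$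
   Context: The discrete Laplace operator $\Delta_d$ is defined, for $f:\mathbb{Z}\to\mathbb{R}$, by $\Delta_d f(x)=f(x+1)-2f(x)+f(x-1)$, $x\in\mathbb{Z}$; in the equation it acts on the space variable $y$. The functions $\kappa$ and $u_0$ are real-valued. The number of zero-crossings of a function $f:\mathbb{Z}\to\mathbb{R}$ is $$\Sigma(f):=0\vee\sup\{n\ge1:\exists\,x_1<\dots<x_{n+1}\text{ in }\mathbb{Z}\text{ such that }f(x_i)f(x_{i+1})<0\text{ for }1\le i\le n\}.$$
   Formalization: The solution u is additionally assumed bounded on [0,T]×ℤ for every T, since Tychonoff-type unbounded solutions with κ=0, u₀=0 violate the claim; solutions are understood as locally absolutely continuous in time with the equation holding for almost every t. *)

theory Defs
  imports
    "HOL-Analysis.Analysis"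
    "HOL-Library.Extended_Nat"
    "HOL-Library.Extended"
begin

definition discrete_laplace :: "(int \<Rightarrow> real) \<Rightarrow> int \<Rightarrow> real" where
  "discrete_laplace f x = f (x + 1) - 2 * f x + f (x - 1)"

definition zero_crossings :: "(int \<Rightarrow> real) \<Rightarrow> enat" where
  "zero_crossings f =
     max 0 (Sup {enat n | n. n \<ge> 1 \<and>
       (\<exists>x :: nat \<Rightarrow> int. strict_mono_on {1..n + 1} x \<and>
          (\<forall>i\<in>{1..n}. f (x i) * f (x (i + 1)) < 0))})"

text \<open>The space \<open>L\<^sup>\<infinity>([0,\<infinity>) \<times> \<int>)\<close> for the product of Lebesgue measure and counting measure.
  Elements are represented by functions on the whole of \<^typ>\<open>real\<close>; the values at negative
  times are irrelevant, here and below.\<close>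

definition L_infinity :: "(real \<Rightarrow> int \<Rightarrow> real) \<Rightarrow> bool" where
  "L_infinity \<kappa> \<longleftrightarrow>
     (\<lambda>(t, y). \<kappa> t y) \<in> borel_measurable (lebesgue_on {0..} \<Otimes>\<^sub>M count_space UNIV) \<and>
     (\<exists>C. AE (t, y) in lebesgue_on {0..} \<Otimes>\<^sub>M count_space UNIV. \<bar>\<kappa> t y\<bar> \<le> C)"

text \<open>Absolute continuity of a real function on a compact interval. (The library constant
  \<^const>\<open>absolutely_continuous\<close> is the unrelated notion for measures.)\<close>

definition abs_cont_on :: "real \<Rightarrow> real \<Rightarrow> (real \<Rightarrow> real) \<Rightarrow> bool" where
  "abs_cont_on A B f \<longleftrightarrow>
     (\<forall>\<epsilon>>0. \<exists>\<delta>>0. \<forall>(n :: nat) (a :: nat \<Rightarrow> real) (b :: nat \<Rightarrow> real).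
        (\<forall>i<n. A \<le> a i \<and> a i \<le> b i \<and> b i \<le> B) \<and>
        disjoint_family_on (\<lambda>i. {a i<..<b i}) {..<n} \<and>
        (\<Sum>i<n. b i - a i) < \<delta>
        \<longrightarrow> (\<Sum>i<n. \<bar>f (b i) - f (a i)\<bar>) < \<epsilon>)"

text \<open>Solutions of the Cauchy problem. As the potential is only an element of \<open>L\<^sup>\<infinity>\<close>, defined up
  to null sets, solutions are understood in the sense of Caratheodory: locally absolutely
  continuous in time (hence continuous at time 0), with the equation holding at almost every time.
  Bounded classical solutions are included.

  Some growth restriction in space is implicit in the problem, since otherwise there is no
  uniqueness and nothing can be said about sign changes: for a smooth bump \<open>g\<close> supported in
  \<open>[1,2]\<close>, the recursion \<open>u(t,y+1) = 2 \<partial>\<^sub>t u(t,y) + 2 u(t,y) - u(t,y-1)\<close>, started symmetrically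
  with \<open>u(t,0) = g(t)\<close> and \<open>u(t,1) = u(t,-1) = g'(t) + g(t)\<close>, gives a sign-changing solution with
  zero initial datum and zero potential. We require boundedness on \<open>[0,T] \<times> \<int>\<close> for every \<open>T\<close>,
  which is weaker than local boundedness in time with values in \<open>\<ell>\<^sup>1(\<int>)\<close>.\<close>

definition is_solution ::
  "(real \<Rightarrow> int \<Rightarrow> real) \<Rightarrow> (int \<Rightarrow> real) \<Rightarrow> (real \<Rightarrow> int \<Rightarrow> real) \<Rightarrow> bool" where
  "is_solution \<kappa> u\<^sub>0 u \<longleftrightarrow>
     (\<forall>y. u 0 y = u\<^sub>0 y) \<and>
     (\<forall>y. \<forall>T>0. abs_cont_on 0 T (\<lambda>t. u t y)) \<and>
     (\<forall>y. AE t in lebesgue. t > 0 \<longrightarrow>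
        ((\<lambda>t. u t y) has_real_derivative
          (1 / 2 * discrete_laplace (u t) y - \<kappa> t y * u t y)) (at t)) \<and>
     (\<forall>T\<ge>0. \<exists>C. \<forall>t\<in>{0..T}. \<forall>y. \<bar>u t y\<bar> \<le> C)"

end

theory Submission
  imports Defs
begin

text \<open>Only one consequence of the equation is used: up to second order in the step size, an Euler step
  for \<open>u\<close> makes an error of at most a constant times \<open>h \<bar>u(t,y)\<bar>\<close>, whatever the
  potential. This error can be absorbed in a positive multiplier depending on time and space, so \<open>u(t)\<close>
  is a pointwise limit of compositions of the maps
  \<open>f \<mapsto> f + (h/2) f(\<cdot> + 1)\<close>, \<open>f \<mapsto> f + (h/2) f(\<cdot> - 1)\<close>
  and multiplications by positive functions, applied to \<open>u(s)\<close>. None of these maps increases the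
  number of sign changes, and that number is lower semicontinuous under pointwise limits.

  For the second part, the kernel of the compositions is compared with that of the case without
  potential; its superexponential decay shows that \<open>u(t)\<close> stays negative far to the left and positive far to
  the right. Zeros between negative values are excluded by perturbing the initial datum with a
  small point mass, which would produce a second sign change.\<close>

section \<open>Increments of absolutely continuous functions\<close>

text \<open>A mean value inequality for derivatives that exist only almost everywhere, by a
  Henstock-type covering. Subintervals tagged in the null set are short in total, so absolute
  continuity makes their contribution small; on the others the derivative bound applies.\<close>

lemma abs_cont_on_increment_bound:
  assumes ac: "abs_cont_on A B f" and AB: "A \<le> s" "s \<le> t" "t \<le> B" and M: "M \<ge> 0"
    and ae: "AE x in lebesgue. s < x \<and> x < t \<longrightarrow>
      (\<exists>D. (f has_real_derivative D) (at x) \<and> \<bar>D - c\<bar> \<le> M)"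
  shows "\<bar>f t - f s - c * (t - s)\<bar> \<le> M * (t - s)"
proof (rule field_le_epsilon)
  fix e :: real assume e: "e > 0"
  define g where "g x = f x - c * x" for x
  \<comment> \<open>The summand 1 keeps the denominator positive when \<open>s = t\<close>.\<close>
  define \<eta> where "\<eta> = e / (2 * (t - s + 1))"
  have \<eta>: "\<eta> > 0" using e AB by (simp add: \<eta>_def)
  have "\<eta> * (t - s) \<le> \<eta> * (t - s + 1)" using \<eta> by (intro mult_left_mono) auto
  also have "\<dots> = e / 2" using AB unfolding \<eta>_def by (simp add: field_simps)
  finally have \<eta>_small: "\<eta> * (t - s) \<le> e / 2" .
  obtain N0 where N0: "N0 \<in> null_sets lebesgue" and
    good0: "\<And>x. x \<notin> N0 \<Longrightarrow> s < x \<and> x < t \<Longrightarrow>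
      \<exists>D. (f has_real_derivative D) (at x) \<and> \<bar>D - c\<bar> \<le> M"
    using AE_E3[OF ae] by (metis (no_types, lifting) DiffI UNIV_I space_completion space_lborel space_borel)
  \<comment> \<open>The endpoints may be tags, but the derivative is controlled only in the open
    interval; they join the exceptional set.\<close>
  define N where "N = N0 \<union> {s, t}"
  have N: "N \<in> null_sets lebesgue"
    unfolding N_def by (intro null_sets.Un N0) (simp add: negligible_iff_null_sets[symmetric])
  have good: "\<exists>d>0. \<forall>y. \<bar>y - x\<bar> < d \<longrightarrow> \<bar>g y - g x\<bar> \<le> (M + \<eta>) * \<bar>y - x\<bar>"
    if x: "x \<in> {s..t} - N" for x
  proof -
    obtain D where D: "(f has_real_derivative D) (at x)" "\<bar>D - c\<bar> \<le> M"
      using good0[of x] x unfolding N_def by force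
    obtain d where d: "d > 0"
      "\<And>y. \<bar>y - x\<bar> < d \<Longrightarrow> \<bar>f y - f x - D * (y - x)\<bar> \<le> \<eta> * \<bar>y - x\<bar>"
      using D(1) \<eta> unfolding has_field_derivative_def has_derivative_at_alt by (auto 0 4)
    have "\<bar>g y - g x\<bar> \<le> (M + \<eta>) * \<bar>y - x\<bar>" if y: "\<bar>y - x\<bar> < d" for y
    proof -
      have "g y - g x = (f y - f x - D * (y - x)) + (D - c) * (y - x)"
        by (simp add: g_def algebra_simps)
      then have "\<bar>g y - g x\<bar> \<le> \<bar>f y - f x - D * (y - x)\<bar> + \<bar>(D - c) * (y - x)\<bar>"
        by (metis abs_triangle_ineq)
      also have "\<bar>(D - c) * (y - x)\<bar> \<le> M * \<bar>y - x\<bar>"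
        using D(2) by (simp add: abs_mult mult_right_mono)
      finally show ?thesis using d(2)[OF y] by (simp add: algebra_simps)
    qed
    then show ?thesis using d(1) by blast
  qed
  then obtain d where d: "\<And>x. x \<in> {s..t} - N \<Longrightarrow> d x > 0"
    "\<And>x y. x \<in> {s..t} - N \<Longrightarrow> \<bar>y - x\<bar> < d x \<Longrightarrow> \<bar>g y - g x\<bar> \<le> (M + \<eta>) * \<bar>y - x\<bar>"
    by metis
  have "e / 4 > 0" using e by simp
  obtain \<delta>0 where \<delta>0: "\<delta>0 > 0" and \<delta>0_ac': "\<forall>(n :: nat) a b.
     (\<forall>i<n. A \<le> a i \<and> a i \<le> b i \<and> b i \<le> B) \<and>
     disjoint_family_on (\<lambda>i. {a i<..<b i}) {..<n} \<and> (\<Sum>i<n. b i - a i) < \<delta>0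
      \<longrightarrow> (\<Sum>i<n. \<bar>f (b i) - f (a i)\<bar>) < e / 4"
    using ac[unfolded abs_cont_on_def, rule_format, OF \<open>e / 4 > 0\<close>] by blast
  note \<delta>0_ac = \<delta>0_ac'[rule_format, OF conjI[OF _ conjI]]
  \<comment> \<open>The first entry controls the increments of \<open>f\<close> on the exceptional
    intervals, the second those of the linear part \<open>c * x\<close>.\<close>
  define \<delta> where "\<delta> = min \<delta>0 (e / (4 * (\<bar>c\<bar> + 1)))"
  have \<delta>: "\<delta> > 0" "\<delta> \<le> \<delta>0" using \<delta>0 e by (auto simp: \<delta>_def)
  have "\<bar>c\<bar> * \<delta> \<le> (\<bar>c\<bar> + 1) * (e / (4 * (\<bar>c\<bar> + 1)))"
    using \<delta>(1) by (intro mult_mono) (auto simp: \<delta>_def)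
  also have "\<dots> = e / 4" by (simp add: divide_simps)
  finally have c\<delta>: "\<bar>c\<bar> * \<delta> \<le> e / 4" .
  obtain U where U: "open U" "N \<subseteq> U" "U - N \<in> lmeasurable" "emeasure lebesgue (U - N) < ennreal \<delta>"
    using sets_lebesgue_outer_open[of N \<delta>] N \<delta> by blast
  have U_eq: "U = N \<union> (U - N)" using U(2) by auto
  have U_lm: "U \<in> lmeasurable"
    using U_eq U(3) N by (metis fmeasurable.Un fmeasurableI_null_sets)
  have U_meas: "measure lebesgue U < \<delta>"
  proof -
    have "emeasure lebesgue U = emeasure lebesgue (U - N)"
      using N U_lm by (simp add: emeasure_Diff_null_set fmeasurableD)
    with U(4) have "emeasure lebesgue U < ennreal \<delta>" by simp
    then show ?thesis
      using U_lm \<delta>(1) by (simp add: emeasure_eq_measure2 ennreal_less_iff)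
  qed
  \<comment> \<open>Intervals tagged in \<open>N\<close> are only forced into \<open>U\<close>;
    having disjoint interiors, they have total length below \<delta>.\<close>
  define \<gamma> where "\<gamma> x = (if x \<in> N then U else if x \<in> {s..t} then ball x (d x) else ball x 1)" for x
  have "gauge \<gamma>"
    unfolding gauge_def \<gamma>_def using U d(1) by auto
  then obtain p where p: "p tagged_division_of {s..t}" "\<gamma> fine p"
    using fine_division_exists_real by blast
  have fin: "finite p" using p(1) by blast
  have K: "\<exists>u v. K = {u..v} \<and> s \<le> u \<and> u \<le> x \<and> x \<le> v \<and> v \<le> t \<and> K \<subseteq> \<gamma> x"
    if "(x, K) \<in> p" for x K
  proof -
    obtain u v where uv: "K = {u..v}"
      using tagged_division_ofD(4)[OF p(1) \<open>(x, K) \<in> p\<close>] by auto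
    have "x \<in> K" "K \<subseteq> {s..t}" "K \<subseteq> \<gamma> x"
      using tagged_division_ofD(2,3)[OF p(1) that] fineD[OF p(2) that] by auto
    then show ?thesis using uv by auto
  qed
  define q where "q = {z \<in> p. fst z \<in> N}"
  have q: "finite q" "q \<subseteq> p" using fin by (auto simp: q_def)
  define l r where "l z = Inf (snd z)" and "r z = Sup (snd z)" for z :: "real \<times> real set"
  have lr: "snd z = {l z..r z} \<and> s \<le> l z \<and> l z \<le> fst z \<and> fst z \<le> r z \<and> r z \<le> t \<and> snd z \<subseteq> \<gamma> (fst z)"
    if "z \<in> p" for z
    using K[of "fst z" "snd z"] that unfolding l_def r_def by auto
  have disj: "{l z<..<r z} \<inter> {l w<..<r w} = {}" if "z \<in> p" "w \<in> p" "z \<noteq> w" for z w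
    using tagged_division_ofD(5)[OF p(1), of "fst z" "snd z" "fst w" "snd w"] that lr[of z] lr[of w]
    by (metis interior_atLeastAtMost_real prod.collapse)
  have disjq: "disjoint_family_on (\<lambda>z. {l z<..<r z}) q"
    unfolding disjoint_family_on_def using disj q(2) by blast
  have "(\<Sum>z\<in>q. r z - l z) = (\<Sum>z\<in>q. measure lebesgue {l z<..<r z})"
  proof (rule sum.cong[OF refl])
    fix z assume "z \<in> q"
    then have "l z \<le> r z" using lr[of z] q(2) by force
    then show "r z - l z = measure lebesgue {l z<..<r z}" by simp
  qed
  also have "\<dots> = measure lebesgue (\<Union>z\<in>q. {l z<..<r z})"
  proof (rule measure_finite_Union[symmetric, OF q(1) _ disjq])
    fix z assume "z \<in> q"
    then have "l z \<le> r z" using lr[of z] q(2) by force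
    then show "emeasure lebesgue {l z<..<r z} \<noteq> \<infinity>" by simp
  qed auto
  also have "\<dots> \<le> measure lebesgue U"
  proof (rule measure_mono_fmeasurable[OF _ _ U_lm])
    show "(\<Union>z\<in>q. {l z<..<r z}) \<subseteq> U"
    proof
      fix x assume "x \<in> (\<Union>z\<in>q. {l z<..<r z})"
      then obtain z where z: "z \<in> q" "x \<in> {l z<..<r z}" by blast
      then have "x \<in> snd z" "snd z \<subseteq> \<gamma> (fst z)" using lr[of z] q(2) by auto
      then show "x \<in> U" using z(1) by (auto simp: q_def \<gamma>_def)
    qed
  qed (use q(1) in auto)
  finally have len_q: "(\<Sum>z\<in>q. r z - l z) < \<delta>" using U_meas by simp
  have sum_f_q: "(\<Sum>z\<in>q. \<bar>f (r z) - f (l z)\<bar>) < e / 4"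
  proof -
    obtain h where h: "bij_betw h {..<card q} q"
      using ex_bij_betw_nat_finite[OF q(1)] by (auto simp: atLeast0LessThan)
    have "(\<Sum>i<card q. \<bar>f (r (h i)) - f (l (h i))\<bar>) < e / 4"
    proof (rule \<delta>0_ac)
      show "\<forall>i<card q. A \<le> l (h i) \<and> l (h i) \<le> r (h i) \<and> r (h i) \<le> B"
      proof (intro allI impI)
        fix i assume "i < card q"
        then have "h i \<in> p" using h q(2) by (auto simp: bij_betw_def)
        from lr[OF this] show "A \<le> l (h i) \<and> l (h i) \<le> r (h i) \<and> r (h i) \<le> B" using AB by auto
      qed
      show "disjoint_family_on (\<lambda>i. {l (h i)<..<r (h i)}) {..<card q}"
        using h disjq unfolding disjoint_family_on_def bij_betw_def inj_on_def by blast
      show "(\<Sum>i<card q. r (h i) - l (h i)) < \<delta>0"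
        using sum.reindex_bij_betw[OF h, of "\<lambda>z. r z - l z"] len_q \<delta>(2) by simp
    qed
    then show ?thesis
      using sum.reindex_bij_betw[OF h, of "\<lambda>z. \<bar>f (r z) - f (l z)\<bar>"] by simp
  qed
  have sum_p: "(\<Sum>z\<in>p. F (r z) - F (l z)) = F t - F s" for F :: "real \<Rightarrow> real"
    using additive_tagged_division_1[OF AB(2) p(1), of F]
    by (simp add: case_prod_beta l_def r_def)
  have "(\<Sum>z\<in>q. \<bar>g (r z) - g (l z)\<bar>) \<le> (\<Sum>z\<in>q. \<bar>f (r z) - f (l z)\<bar> + \<bar>c\<bar> * (r z - l z))"
  proof (rule sum_mono)
    fix z assume "z \<in> q"
    then have "l z \<le> r z" using lr[of z] q(2) by auto
    have "g (r z) - g (l z) = (f (r z) - f (l z)) - c * (r z - l z)"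
      by (simp add: g_def algebra_simps)
    then have "\<bar>g (r z) - g (l z)\<bar> \<le> \<bar>f (r z) - f (l z)\<bar> + \<bar>c * (r z - l z)\<bar>"
      by (metis abs_triangle_ineq4)
    then show "\<bar>g (r z) - g (l z)\<bar> \<le> \<bar>f (r z) - f (l z)\<bar> + \<bar>c\<bar> * (r z - l z)"
      using \<open>l z \<le> r z\<close> by (simp add: abs_mult)
  qed
  also have "\<dots> = (\<Sum>z\<in>q. \<bar>f (r z) - f (l z)\<bar>) + \<bar>c\<bar> * (\<Sum>z\<in>q. r z - l z)"
    by (simp add: sum.distrib sum_distrib_left)
  also have "\<dots> \<le> e / 4 + \<bar>c\<bar> * \<delta>"
    using sum_f_q len_q by (intro add_mono mult_left_mono) auto
  finally have bad: "(\<Sum>z\<in>q. \<bar>g (r z) - g (l z)\<bar>) \<le> e / 2" using c\<delta> by simp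
  have "(\<Sum>z\<in>p - q. \<bar>g (r z) - g (l z)\<bar>) \<le> (\<Sum>z\<in>p - q. (M + \<eta>) * (r z - l z))"
  proof (rule sum_mono)
    fix z assume z: "z \<in> p - q"
    define x where "x = fst z"
    have x: "x \<in> {s..t} - N" "l z \<le> x" "x \<le> r z" "snd z \<subseteq> ball x (d x)" "snd z = {l z..r z}"
      using lr[of z] z by (auto simp: x_def q_def \<gamma>_def)
    have "r z \<in> ball x (d x)" "l z \<in> ball x (d x)" using x by force+
    then have "\<bar>r z - x\<bar> < d x" "\<bar>l z - x\<bar> < d x" by (auto simp: dist_real_def)
    \<comment> \<open>The tag lies between the endpoints, so the two distances add up to exactly the
      length of the interval.\<close>
    from d(2)[OF x(1) this(1)] d(2)[OF x(1) this(2)]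
    have "\<bar>g (r z) - g x\<bar> \<le> (M + \<eta>) * (r z - x)" "\<bar>g (l z) - g x\<bar> \<le> (M + \<eta>) * (x - l z)"
      using x by auto
    moreover have "(M + \<eta>) * (r z - x) + (M + \<eta>) * (x - l z) = (M + \<eta>) * (r z - l z)"
      by (simp add: algebra_simps)
    ultimately show "\<bar>g (r z) - g (l z)\<bar> \<le> (M + \<eta>) * (r z - l z)" by linarith
  qed
  also have "\<dots> \<le> (\<Sum>z\<in>p. (M + \<eta>) * (r z - l z))"
  proof (rule sum_mono2[OF fin])
    fix z assume "z \<in> p - (p - q)"
    then have "l z \<le> r z" using lr[of z] by force
    then show "0 \<le> (M + \<eta>) * (r z - l z)" using M \<eta> by simp
  qed simp
  also have "\<dots> = (M + \<eta>) * (t - s)"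
    using sum_p[of "\<lambda>x. x"] by (simp add: sum_distrib_left[symmetric])
  also have "\<dots> \<le> M * (t - s) + e / 2" using \<eta>_small by (simp add: algebra_simps)
  finally have ok: "(\<Sum>z\<in>p - q. \<bar>g (r z) - g (l z)\<bar>) \<le> M * (t - s) + e / 2" .
  have "f t - f s - c * (t - s) = (\<Sum>z\<in>p. g (r z) - g (l z))"
    unfolding sum_p by (simp add: g_def algebra_simps)
  also have "\<bar>\<dots>\<bar> \<le> (\<Sum>z\<in>p. \<bar>g (r z) - g (l z)\<bar>)" by (rule sum_abs)
  also have "\<dots> = (\<Sum>z\<in>p - q. \<bar>g (r z) - g (l z)\<bar>) + (\<Sum>z\<in>q. \<bar>g (r z) - g (l z)\<bar>)"
    using sum.subset_diff[OF q(2) fin] .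
  finally show "\<bar>f t - f s - c * (t - s)\<bar> \<le> M * (t - s) + e" using ok bad by simp
qed

section \<open>Sign changes\<close>

text \<open>Only neighbouring points are compared, so each argument below treats one pair at a time.
  The case \<open>n = 0\<close> is always true, and only positions 1 to \<open>n + 1\<close> of
  \<open>x\<close> matter.\<close>

definition alternates :: "(int \<Rightarrow> real) \<Rightarrow> nat \<Rightarrow> bool" where
  "alternates f n \<longleftrightarrow> (\<exists>x :: nat \<Rightarrow> int. \<forall>i\<in>{1..n}. x i < x (i + 1) \<and> f (x i) * f (x (i + 1)) < 0)"

lemma alternates_iff:
  "alternates f n \<longleftrightarrow> (\<exists>x :: nat \<Rightarrow> int. strict_mono_on {1..n + 1} x \<and>
     (\<forall>i\<in>{1..n}. f (x i) * f (x (i + 1)) < 0))"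
proof
  assume "alternates f n"
  then obtain x :: "nat \<Rightarrow> int" where x: "\<And>i. i \<in> {1..n} \<Longrightarrow> x i < x (i + 1)"
      "\<forall>i\<in>{1..n}. f (x i) * f (x (i + 1)) < 0"
    unfolding alternates_def by blast
  have "x i < x j" if "i < j" "1 \<le> i" "j \<le> n + 1" for i j
    using that
  proof (induction j)
    case (Suc j)
    show ?case
    proof (cases "i = j")
      case True
      then show ?thesis using x(1)[of j] Suc.prems by simp
    next
      case False
      then have "x i < x j" using Suc by simp
      also have "x j < x (Suc j)" using x(1)[of j] Suc.prems by simp
      finally show ?thesis .
    qed
  qed simp
  then have "strict_mono_on {1..n + 1} x" by (intro strict_mono_onI) auto
  then show "\<exists>x :: nat \<Rightarrow> int. strict_mono_on {1..n + 1} x \<and>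
     (\<forall>i\<in>{1..n}. f (x i) * f (x (i + 1)) < 0)" using x(2) by blast
next
  assume "\<exists>x :: nat \<Rightarrow> int. strict_mono_on {1..n + 1} x \<and>
     (\<forall>i\<in>{1..n}. f (x i) * f (x (i + 1)) < 0)"
  then obtain x :: "nat \<Rightarrow> int" where x: "strict_mono_on {1..n + 1} x"
      "\<forall>i\<in>{1..n}. f (x i) * f (x (i + 1)) < 0" by blast
  have "x i < x (i + 1)" if "i \<in> {1..n}" for i
    using that by (intro strict_mono_onD[OF x(1)]) auto
  then show "alternates f n" unfolding alternates_def using x(2) by blast
qed

text \<open>Reduces an inequality in \<open>enat\<close> to finite numbers of sign changes, so that
  infinite values need no separate case.\<close>

lemma zero_crossings_mono:
  assumes "\<And>n. alternates f n \<Longrightarrow> alternates g n"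
  shows "zero_crossings f \<le> zero_crossings g"
  unfolding zero_crossings_def alternates_iff[symmetric]
  using assms by (intro max.mono Sup_subset_mono) auto

text \<open>Lower semicontinuity: finitely many strict inequalities at fixed points are stable under
  pointwise convergence.\<close>

lemma alternates_limit:
  assumes lim: "\<And>y. (\<lambda>k. F k y) \<longlonglongrightarrow> f y" and alt: "alternates f n"
  shows "\<forall>\<^sub>F k in sequentially. alternates (F k) n"
proof -
  obtain x :: "nat \<Rightarrow> int" where x: "\<forall>i\<in>{1..n}. x i < x (i + 1) \<and> f (x i) * f (x (i + 1)) < 0"
    using alt unfolding alternates_def by blast
  have "\<forall>\<^sub>F k in sequentially. \<forall>i\<in>{1..n}. F k (x i) * F k (x (i + 1)) < 0"
  proof (intro eventually_ball_finite ballI)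
    fix i assume "i \<in> {1..n}"
    have "(\<lambda>k. F k (x i) * F k (x (i + 1))) \<longlonglongrightarrow> f (x i) * f (x (i + 1))"
      by (intro tendsto_mult lim)
    then show "\<forall>\<^sub>F k in sequentially. F k (x i) * F k (x (i + 1)) < 0"
      by (rule order_tendstoD) (use x \<open>i \<in> {1..n}\<close> in auto)
  qed simp
  then show ?thesis
    unfolding alternates_def using x by (auto elim!: eventually_mono)
qed

text \<open>With \<open>c = h / 2\<close>, composing the directions 1 and -1 and multiplying by
  \<open>1 - h\<close> gives the Euler step \<open>f + h / 2 * discrete_laplace f\<close> up to
  order h^2. Each factor looks to one side only, which keeps neighbouring points from changing
  places in \<open>alternates_smear\<close>.\<close>

definition smear :: "int \<Rightarrow> real \<Rightarrow> (int \<Rightarrow> real) \<Rightarrow> int \<Rightarrow> real" where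
  "smear \<sigma> c f x = f x + c * f (x + \<sigma>)"

text \<open>A point where \<open>smear \<sigma> c f\<close> is nonzero has, at distance 0 or 1, a point where \<open>f\<close> has the same
  sign; the points chosen this way stay in strict order because the signs alternate.\<close>

lemma alternates_smear:
  assumes c: "c \<ge> 0" and \<sigma>: "\<bar>\<sigma>\<bar> = 1" and alt: "alternates (smear \<sigma> c f) n"
  shows "alternates f n"
proof -
  let ?g = "smear \<sigma> c f"
  obtain x :: "nat \<Rightarrow> int" where x: "\<And>i. i \<in> {1..n} \<Longrightarrow> x i < x (i + 1)"
      "\<And>i. i \<in> {1..n} \<Longrightarrow> ?g (x i) * ?g (x (i + 1)) < 0"
    using alt unfolding alternates_def by blast
  define y where "y i = (if f (x i) * ?g (x i) > 0 then x i else x i + \<sigma>)" for i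
  have y: "f (y i) * ?g (x i) > 0" if "?g (x i) \<noteq> 0" for i
  proof (cases "f (x i) * ?g (x i) > 0")
    case False
    have "f (x i) * ?g (x i) + c * (f (x i + \<sigma>) * ?g (x i)) = ?g (x i) * ?g (x i)"
      by (simp add: smear_def algebra_simps)
    also have "\<dots> > 0" using that by (auto simp: zero_less_mult_iff)
    finally have "c * (f (x i + \<sigma>) * ?g (x i)) > 0" using False by linarith
    then have "f (x i + \<sigma>) * ?g (x i) > 0" using c by (simp add: zero_less_mult_iff)
    then show ?thesis using False by (simp add: y_def)
  qed (simp add: y_def)
  have "y i < y (i + 1) \<and> f (y i) * f (y (i + 1)) < 0" if i: "i \<in> {1..n}" for i
  proof -
    have "?g (x i) \<noteq> 0" "?g (x (i + 1)) \<noteq> 0" using x(2)[OF i] by auto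
    then have "f (y i) * ?g (x i) > 0" "f (y (i + 1)) * ?g (x (i + 1)) > 0" using y by blast+
    with x(2)[OF i] have neg: "f (y i) * f (y (i + 1)) < 0"
      by (auto simp: zero_less_mult_iff mult_less_0_iff)
    then have "f (y i) \<noteq> f (y (i + 1))" by (auto simp: mult_less_0_iff)
    then have "y i \<noteq> y (i + 1)" by auto
    \<comment> \<open>Each point moves by 0 or by the same \<sigma>, so an integer gap of at least 1
      shrinks by at most 1.\<close>
    moreover have "y i \<le> y (i + 1)"
      using x(1)[OF i] \<sigma> unfolding y_def by (auto split: if_splits)
    ultimately show ?thesis using neg by simp
  qed
  then show ?thesis unfolding alternates_def by (intro exI[of _ y] ballI)
qed

lemma alternates_scale:
  assumes d: "\<And>y. d y > 0" and alt: "alternates (\<lambda>y. d y * f y) n"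
  shows "alternates f n"
proof -
  have "d x * f x * (d y * f y) < 0 \<longleftrightarrow> f x * f y < 0" for x y
    unfolding mult_less_0_iff zero_less_mult_iff using d[of x] d[of y] by auto
  then show ?thesis using alt unfolding alternates_def by simp
qed

lemma smear_mono: "c \<ge> 0 \<Longrightarrow> (\<And>y. f y \<le> g y) \<Longrightarrow> smear \<sigma> c f y \<le> smear \<sigma> c g y"
  unfolding smear_def by (intro add_mono mult_left_mono) auto

lemma smear_linear:
  "smear \<sigma> c (\<lambda>y. a * f y + b * g y) = (\<lambda>y. a * smear \<sigma> c f y + b * smear \<sigma> c g y)"
  by (rule ext) (simp add: smear_def algebra_simps)

lemma smear_commute: "smear \<sigma> c (smear \<rho> d f) = smear \<rho> d (smear \<sigma> c f)"
  by (rule ext) (simp add: smear_def distrib_left ac_simps)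

lemma abs_smear_le: "c \<ge> 0 \<Longrightarrow> (\<And>y. \<bar>f y\<bar> \<le> M) \<Longrightarrow> \<bar>smear \<sigma> c f y\<bar> \<le> (1 + c) * M"
proof -
  assume c: "c \<ge> 0" and M: "\<And>y. \<bar>f y\<bar> \<le> M"
  have "\<bar>smear \<sigma> c f y\<bar> \<le> \<bar>f y\<bar> + c * \<bar>f (y + \<sigma>)\<bar>"
    using c abs_triangle_ineq[of "f y" "c * f (y + \<sigma>)"] by (simp add: smear_def abs_mult)
  also have "\<dots> \<le> M + c * M" using c M by (intro add_mono mult_left_mono) auto
  finally show ?thesis by (simp add: algebra_simps)
qed

section \<open>Splitting schemes\<close>

text \<open>Here \<open>c\<close> is half the step size and \<open>d k y\<close> carries the
  potential. The multipliers do not depend on \<open>f\<close>: for fixed \<open>d\<close> the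
  scheme is linear in \<open>f\<close>, even though \<open>d\<close> is later read off from one
  particular solution.\<close>

primrec scheme :: "real \<Rightarrow> (nat \<Rightarrow> int \<Rightarrow> real) \<Rightarrow> nat \<Rightarrow> (int \<Rightarrow> real) \<Rightarrow> int \<Rightarrow> real" where
  "scheme c d 0 f = f"
| "scheme c d (Suc k) f = (\<lambda>y. d k y * smear 1 c (smear (-1) c (scheme c d k f)) y)"

lemma alternates_scheme:
  assumes "c \<ge> 0" "\<And>k y. k < n \<Longrightarrow> d k y > 0" "alternates (scheme c d n f) N"
  shows "alternates f N"
  using assms
proof (induction n)
  case (Suc n)
  have "alternates (smear 1 c (smear (-1) c (scheme c d n f))) N"
    by (rule alternates_scale[where d = "d n"]) (use Suc.prems(2,3) in auto)
  then have "alternates (smear (-1) c (scheme c d n f)) N"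
    by (rule alternates_smear[OF Suc.prems(1), rotated]) simp
  then have "alternates (scheme c d n f) N"
    by (rule alternates_smear[OF Suc.prems(1), rotated]) simp
  then show ?case using Suc.IH Suc.prems(1,2) by simp
qed simp

lemma scheme_linear:
  "scheme c d n (\<lambda>y. a * f y + b * g y) = (\<lambda>y. a * scheme c d n f y + b * scheme c d n g y)"
proof (induction n)
  case (Suc n)
  show ?case by (simp only: scheme.simps Suc smear_linear) (simp add: fun_eq_iff algebra_simps)
qed simp

lemma scheme_mono:
  assumes "c \<ge> 0" "\<And>k y. k < n \<Longrightarrow> d k y \<ge> 0" "\<And>y. f y \<le> g y"
  shows "scheme c d n f y \<le> scheme c d n g y"
  using assms
proof (induction n arbitrary: y)
  case (Suc n)
  have "scheme c d n f z \<le> scheme c d n g z" for z using Suc by simp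
  then have "smear 1 c (smear (-1) c (scheme c d n f)) y \<le> smear 1 c (smear (-1) c (scheme c d n g)) y"
    using Suc.prems(1) by (intro smear_mono)
  then show ?case using Suc.prems(2)[of n y] by (simp add: mult_left_mono)
qed simp

lemma smear_power_ge:
  assumes "c \<ge> 0" "\<And>y. f y \<ge> 0"
  shows "f y \<le> (smear \<sigma> c ^^ n) f y"
proof -
  have "(\<forall>y. 0 \<le> (smear \<sigma> c ^^ n) f y) \<and> (\<forall>y. f y \<le> (smear \<sigma> c ^^ n) f y)"
  proof (induction n)
    case (Suc n)
    have "(smear \<sigma> c ^^ n) f y \<le> (smear \<sigma> c ^^ Suc n) f y" for y
      using Suc assms(1) by (simp add: smear_def[of _ _ "(smear \<sigma> c ^^ n) f"])
    with Suc show ?case by (meson order_trans)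
  qed (use assms in auto)
  then show ?thesis by blast
qed

lemma smear_power_nonneg:
  assumes "c \<ge> 0" "\<And>y. f y \<ge> 0"
  shows "0 \<le> (smear \<sigma> c ^^ n) f y"
  by (rule order_trans[OF assms(2) smear_power_ge[OF assms]])

lemma smear_power_linear:
  "(smear \<sigma> c ^^ n) (\<lambda>y. a * f y + b * g y) = (\<lambda>y. a * (smear \<sigma> c ^^ n) f y + b * (smear \<sigma> c ^^ n) g y)"
  by (induction n) (simp_all add: smear_linear)

lemma smear_power_commute:
  "smear \<rho> d ((smear \<sigma> c ^^ n) f) = (smear \<sigma> c ^^ n) (smear \<rho> d f)"
proof (induction n)
  case (Suc n)
  then show ?case by (simp add: smear_commute[of \<rho> d \<sigma> c])
qed simp

text \<open>The binomial theorem for the sum of the identity and \<open>c\<close> times the shift by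
  \<sigma>.\<close>

lemma smear_power_eq_sum:
  "(smear \<sigma> c ^^ n) f x = (\<Sum>j\<le>n. real (n choose j) * c ^ j * f (x + int j * \<sigma>))"
proof (induction n arbitrary: x)
  case (Suc n)
  let ?b = "\<lambda>j. real (n choose j) * c ^ j"
  let ?f = "\<lambda>j. f (x + int j * \<sigma>)"
  have shift: "f (x + \<sigma> + int j * \<sigma>) = ?f (Suc j)" for j by (simp add: algebra_simps)
  have "(smear \<sigma> c ^^ Suc n) f x = (\<Sum>j\<le>n. ?b j * ?f j) + c * (\<Sum>j\<le>n. ?b j * ?f (Suc j))"
    by (simp add: smear_def Suc shift)
  also have "(\<Sum>j\<le>n. ?b j * ?f j) = (\<Sum>j\<le>Suc n. ?b j * ?f j)" by simp
  also have "\<dots> = ?f 0 + (\<Sum>j\<le>n. ?b (Suc j) * ?f (Suc j))"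
    by (subst sum.atMost_Suc_shift) simp
  also have "\<dots> + c * (\<Sum>j\<le>n. ?b j * ?f (Suc j)) =
      ?f 0 + (\<Sum>j\<le>n. real (Suc n choose Suc j) * c ^ Suc j * ?f (Suc j))"
    by (simp add: sum_distrib_left sum.distrib[symmetric] algebra_simps)
  also have "\<dots> = (\<Sum>j\<le>Suc n. real (Suc n choose j) * c ^ j * ?f j)"
    by (simp only: sum.atMost_Suc_shift) simp
  finally show ?case .
qed simp

text \<open>The scheme with all multipliers equal to 1. As the shifts commute, the two directions
  are grouped, so that each is a single binomial sum.\<close>

definition smear_both :: "nat \<Rightarrow> real \<Rightarrow> (int \<Rightarrow> real) \<Rightarrow> int \<Rightarrow> real" where
  "smear_both n c f = (smear (-1) c ^^ n) ((smear 1 c ^^ n) f)"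

lemma smear_both_Suc: "smear_both (Suc n) c f = smear 1 c (smear (-1) c (smear_both n c f))"
  unfolding smear_both_def
  by (simp only: funpow.simps comp_apply smear_power_commute[of 1 c, symmetric])
    (rule smear_commute)

lemma smear_both_linear:
  "smear_both n c (\<lambda>y. a * f y + b * g y) = (\<lambda>y. a * smear_both n c f y + b * smear_both n c g y)"
  by (simp add: smear_both_def smear_power_linear)

lemma smear_both_nonneg: "c \<ge> 0 \<Longrightarrow> (\<And>y. f y \<ge> 0) \<Longrightarrow> 0 \<le> smear_both n c f y"
  unfolding smear_both_def by (intro smear_power_nonneg)

text \<open>On nonnegative data the other direction only adds mass, and since the powers commute it
  may be taken to act last.\<close>

lemma smear_both_ge_power:
  assumes "c \<ge> 0" "\<And>y. f y \<ge> 0" "\<sigma> = 1 \<or> \<sigma> = -1"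
  shows "(smear \<sigma> c ^^ n) f y \<le> smear_both n c f y"
proof -
  have comm: "(smear (-1) c ^^ n) ((smear 1 c ^^ m) f) = (smear 1 c ^^ m) ((smear (-1) c ^^ n) f)" for m n
    by (induction m) (simp_all add: smear_power_commute[symmetric])
  from assms(3) show ?thesis
  proof
    assume "\<sigma> = 1"
    then show ?thesis unfolding smear_both_def
      using assms(1,2) by (auto intro!: smear_power_ge smear_power_nonneg)
  next
    assume "\<sigma> = -1"
    then show ?thesis unfolding smear_both_def comm
      using assms(1,2) by (auto intro!: smear_power_ge smear_power_nonneg)
  qed
qed

text \<open>Comparison with the flow without potential: constants pass through the monotone linear
  steps, so bounds on the multipliers accumulate as powers.\<close>

lemma scheme_between:
  assumes "c \<ge> 0" "\<alpha> \<ge> 0" "\<And>k y. k < n \<Longrightarrow> \<alpha> \<le> d k y \<and> d k y \<le> \<beta>" "\<And>y. f y \<ge> 0"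
  shows "\<alpha> ^ n * smear_both n c f y \<le> scheme c d n f y \<and>
     scheme c d n f y \<le> \<beta> ^ n * smear_both n c f y"
  using assms
proof (induction n arbitrary: y)
  case (Suc n)
  let ?W = "smear_both n c f" and ?P = "scheme c d n f"
  let ?E = "\<lambda>f. smear 1 c (smear (-1) c f)"
  have IH: "\<alpha> ^ n * ?W y \<le> ?P y" "?P y \<le> \<beta> ^ n * ?W y" for y
    using Suc.IH[of y] Suc.prems by auto
  have E_scale: "?E (\<lambda>y. a * ?W y) y = a * smear_both (Suc n) c f y" for a y
    by (simp add: smear_both_Suc smear_def algebra_simps)
  have E: "\<alpha> ^ n * smear_both (Suc n) c f y \<le> ?E ?P y" "?E ?P y \<le> \<beta> ^ n * smear_both (Suc n) c f y"
    unfolding E_scale[symmetric] using Suc.prems(1) IH by (auto intro!: smear_mono)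
  have W: "smear_both (Suc n) c f y \<ge> 0" using Suc.prems by (intro smear_both_nonneg)
  have d: "\<alpha> \<le> d n y" "d n y \<le> \<beta>" using Suc.prems(3)[of n] by auto
  have d0: "0 \<le> d n y" using d Suc.prems(2) by simp
  have \<beta>: "0 \<le> \<beta>" using d d0 by simp
  have nn: "0 \<le> \<alpha> ^ n * smear_both (Suc n) c f y" using Suc.prems W by simp
  have "\<alpha> * (\<alpha> ^ n * smear_both (Suc n) c f y) \<le> d n y * ?E ?P y"
    using d d0 \<beta> E nn Suc.prems by (intro mult_mono) auto
  moreover have "d n y * ?E ?P y \<le> \<beta> * (\<beta> ^ n * smear_both (Suc n) c f y)"
    using d d0 \<beta> E nn Suc.prems by (intro mult_mono) auto
  ultimately show ?case by (simp add: mult.assoc)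
qed (simp add: smear_both_def)

section \<open>Approximation of solutions\<close>

lemma sigma_finite_lebesgue: "sigma_finite_measure (lebesgue :: 'a::euclidean_space measure)"
proof
  obtain A :: "'a set set" where A: "countable A" "A \<subseteq> sets lborel" "\<Union>A = space lborel"
      "\<forall>a\<in>A. emeasure lborel a \<noteq> \<infinity>"
    using lborel.sigma_finite_countable by blast
  then show "\<exists>A :: 'a set set. countable A \<and> A \<subseteq> sets lebesgue \<and> \<Union>A = space lebesgue \<and>
      (\<forall>a\<in>A. emeasure lebesgue a \<noteq> \<infinity>)"
    by (intro exI[of _ A]) auto
qed

text \<open>Fubini for null sets. Counting measure has no nonempty null sets, so a single null set
  of times serves all sites.\<close>

lemma L_infinity_AE_bound:
  assumes "L_infinity \<kappa>"
  obtains K where "K \<ge> 0" "AE t in lebesgue. t > 0 \<longrightarrow> (\<forall>y. \<bar>\<kappa> t y\<bar> \<le> K)"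
proof -
  obtain C where C: "AE (t, y) in lebesgue_on {0..} \<Otimes>\<^sub>M count_space UNIV. \<bar>\<kappa> t y\<bar> \<le> C"
    using assms unfolding L_infinity_def by blast
  interpret S2: sigma_finite_measure "count_space (UNIV :: int set)"
    by (rule sigma_finite_measure_count_space)
  interpret S1: sigma_finite_measure "lebesgue_on {0::real..}"
    by (intro sigma_finite_measure_restrict_space sigma_finite_lebesgue) auto
  interpret pair_sigma_finite "lebesgue_on {0::real..}" "count_space (UNIV :: int set)" ..
  have "AE t in lebesgue_on {0..}. AE y in count_space UNIV. \<bar>\<kappa> t y\<bar> \<le> C"
    using AE_pair[OF C] by simp
  then have "AE t in lebesgue. t \<in> {0..} \<longrightarrow> (\<forall>y. \<bar>\<kappa> t y\<bar> \<le> C)"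
    by (simp add: AE_count_space AE_restrict_space_iff)
  then have "AE t in lebesgue. t > 0 \<longrightarrow> (\<forall>y. \<bar>\<kappa> t y\<bar> \<le> max 0 C)"
    by (rule eventually_mono) (auto intro: order_trans)
  then show thesis using that[of "max 0 C"] by simp
qed

text \<open>All that is retained of the equation: an Euler step whose error is, up to second order in the
  step size, a bounded multiple of the current value.\<close>

locale lattice_heat_flow =
  fixes T K L M :: real and u :: "real \<Rightarrow> int \<Rightarrow> real"
  assumes K_nonneg: "0 \<le> K" and L_nonneg: "0 \<le> L" and M_nonneg: "0 \<le> M"
    and u_bound: "\<And>t y. 0 \<le> t \<Longrightarrow> t \<le> T \<Longrightarrow> \<bar>u t y\<bar> \<le> M"
    and euler: "\<And>s t y. 0 \<le> s \<Longrightarrow> s \<le> t \<Longrightarrow> t \<le> T \<Longrightarrow>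
      \<bar>u t y - u s y - (t - s) / 2 * discrete_laplace (u s) y\<bar> \<le>
        K * (t - s) * \<bar>u s y\<bar> + L * (t - s)\<^sup>2"

text \<open>The increment bound is used twice: centred at 0 it gives a Lipschitz estimate in time,
  and centred at the Laplacian frozen at time \<open>s\<close> it then gives the Euler
  estimate.\<close>

lemma is_solution_lattice_heat_flow:
  assumes \<kappa>: "L_infinity \<kappa>" and sol: "is_solution \<kappa> u\<^sub>0 u" and T: "T > 0"
  obtains K L M where "lattice_heat_flow T K L M u"
proof -
  obtain K where K: "K \<ge> 0" "AE t in lebesgue. t > 0 \<longrightarrow> (\<forall>y. \<bar>\<kappa> t y\<bar> \<le> K)"
    using L_infinity_AE_bound[OF \<kappa>] .
  obtain M where M: "\<And>t y. t \<in> {0..T} \<Longrightarrow> \<bar>u t y\<bar> \<le> M"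
    using sol T unfolding is_solution_def by (meson less_imp_le)
  have M0: "M \<ge> 0" using M[of 0 0] T by simp
  have ac: "abs_cont_on 0 T (\<lambda>t. u t y)" for y
    using sol T unfolding is_solution_def by blast
  have deriv: "AE t in lebesgue. t > 0 \<longrightarrow> ((\<lambda>t. u t y) has_real_derivative
      (1 / 2 * discrete_laplace (u t) y - \<kappa> t y * u t y)) (at t) \<and> \<bar>\<kappa> t y\<bar> \<le> K" for y
  proof -
    have "AE t in lebesgue. t > 0 \<longrightarrow> ((\<lambda>t. u t y) has_real_derivative
      (1 / 2 * discrete_laplace (u t) y - \<kappa> t y * u t y)) (at t)"
      using sol unfolding is_solution_def by blast
    with K(2) show ?thesis by eventually_elim auto
  qed
  \<comment> \<open>Half the Laplacian contributes \<open>2 * M\<close>, the potential term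
    \<open>K * M\<close>.\<close>
  define \<Lambda> where "\<Lambda> = (2 + K) * M"
  have \<Lambda>: "\<Lambda> \<ge> 0" using K M0 by (simp add: \<Lambda>_def)
  have lap: "\<bar>discrete_laplace f y\<bar> \<le> 4 * B" if "\<And>z. \<bar>f z\<bar> \<le> B" for f :: "int \<Rightarrow> real" and B y
    using that[of y] that[of "y + 1"] that[of "y - 1"] unfolding discrete_laplace_def by linarith
  have lip: "\<bar>u t y - u s y\<bar> \<le> \<Lambda> * (t - s)" if st: "0 \<le> s" "s \<le> t" "t \<le> T" for s t y
  proof -
    have "AE x in lebesgue. s < x \<and> x < t \<longrightarrow>
      (\<exists>D. ((\<lambda>t. u t y) has_real_derivative D) (at x) \<and> \<bar>D - 0\<bar> \<le> \<Lambda>)"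
      using deriv[of y]
    proof eventually_elim
      case (elim x)
      show ?case
      proof (intro impI exI conjI)
        assume x: "s < x \<and> x < t"
        then have x0: "x > 0" "x \<in> {0..T}" using st by auto
        show "((\<lambda>t. u t y) has_real_derivative
            (1 / 2 * discrete_laplace (u x) y - \<kappa> x y * u x y)) (at x)"
          using elim x0 by blast
        have "\<bar>\<kappa> x y * u x y\<bar> \<le> K * M"
          using elim x0 M[OF x0(2)] K by (auto simp: abs_mult intro!: mult_mono)
        moreover have "\<bar>discrete_laplace (u x) y\<bar> \<le> 4 * M" using M[OF x0(2)] by (rule lap)
        ultimately show "\<bar>1 / 2 * discrete_laplace (u x) y - \<kappa> x y * u x y - 0\<bar> \<le> \<Lambda>"
          unfolding \<Lambda>_def distrib_right by linarith
      qed
    qed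
    from abs_cont_on_increment_bound[OF ac st \<Lambda> this] show ?thesis by simp
  qed
  have "lattice_heat_flow T K ((2 + K) * \<Lambda>) M u"
  proof
    show "0 \<le> K" "0 \<le> (2 + K) * \<Lambda>" "0 \<le> M" using K \<Lambda> M0 by auto
    show "\<bar>u t y\<bar> \<le> M" if "0 \<le> t" "t \<le> T" for t y using M that by auto
    fix s t :: real and y :: int
    assume st: "0 \<le> s" "s \<le> t" "t \<le> T"
    \<comment> \<open>Freezing the Laplacian at time \<open>s\<close> costs
      \<open>2 * \<Lambda> * (t - s)\<close>. The whole potential term counts as error, estimated
      through \<open>\<bar>u x y\<bar> \<le> \<bar>u s y\<bar> + \<Lambda> * (t -
      s)\<close>.\<close>
    let ?B = "K * \<bar>u s y\<bar> + (2 + K) * \<Lambda> * (t - s)"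
    have B0: "?B \<ge> 0" using K \<Lambda> st by (intro add_nonneg_nonneg mult_nonneg_nonneg) auto
    have "AE x in lebesgue. s < x \<and> x < t \<longrightarrow>
      (\<exists>D. ((\<lambda>t. u t y) has_real_derivative D) (at x) \<and>
        \<bar>D - 1 / 2 * discrete_laplace (u s) y\<bar> \<le> ?B)"
      using deriv[of y]
    proof eventually_elim
      case (elim x)
      show ?case
      proof (intro impI exI conjI)
        assume x: "s < x \<and> x < t"
        then have x0: "x > 0" "s \<le> x" "x \<le> T" using st by auto
        show "((\<lambda>t. u t y) has_real_derivative
            (1 / 2 * discrete_laplace (u x) y - \<kappa> x y * u x y)) (at x)"
          using elim x0 by blast
        have le: "\<bar>u x z - u s z\<bar> \<le> \<Lambda> * (t - s)" for z
        proof -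
          have "\<bar>u x z - u s z\<bar> \<le> \<Lambda> * (x - s)" using lip[OF st(1) x0(2,3)] .
          also have "\<dots> \<le> \<Lambda> * (t - s)" using x \<Lambda> by (intro mult_left_mono) auto
          finally show ?thesis .
        qed
        have "\<bar>u x y\<bar> \<le> \<bar>u s y\<bar> + \<Lambda> * (t - s)" using le[of y] by linarith
        then have "\<bar>\<kappa> x y * u x y\<bar> \<le> K * (\<bar>u s y\<bar> + \<Lambda> * (t - s))"
          using elim x0 K by (auto simp: abs_mult intro!: mult_mono)
        moreover have "\<bar>discrete_laplace (\<lambda>z. u x z - u s z) y\<bar> \<le> 4 * (\<Lambda> * (t - s))"
          using le by (rule lap)
        moreover have "discrete_laplace (\<lambda>z. u x z - u s z) y =
            discrete_laplace (u x) y - discrete_laplace (u s) y"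
          by (simp add: discrete_laplace_def)
        ultimately have "\<bar>1 / 2 * discrete_laplace (u x) y - \<kappa> x y * u x y - 1 / 2 * discrete_laplace (u s) y\<bar>
            \<le> 2 * (\<Lambda> * (t - s)) + K * (\<bar>u s y\<bar> + \<Lambda> * (t - s))" by linarith
        also have "\<dots> = ?B" by (simp add: algebra_simps)
        finally show "\<bar>1 / 2 * discrete_laplace (u x) y - \<kappa> x y * u x y - 1 / 2 * discrete_laplace (u s) y\<bar> \<le> ?B" .
      qed
    qed
    from abs_cont_on_increment_bound[OF ac st B0 this]
    show "\<bar>u t y - u s y - (t - s) / 2 * discrete_laplace (u s) y\<bar>
       \<le> K * (t - s) * \<bar>u s y\<bar> + (2 + K) * \<Lambda> * (t - s)\<^sup>2"
      by (simp add: algebra_simps power2_eq_square)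
  qed
  then show thesis by (rule that)
qed

text \<open>Turns an additive error into a multiplicative one: if \<open>e\<close> is at most
  \<open>k * \<bar>v\<bar>\<close> in size, it is itself a multiple of \<open>v\<close>; otherwise
  the extreme multiplier, with the appropriate sign, leaves at most \<open>E\<close>.\<close>

lemma bounded_multiplier:
  fixes e v :: real
  assumes "\<bar>e\<bar> \<le> k * \<bar>v\<bar> + E" "k \<ge> 0" "E \<ge> 0"
  shows "\<exists>a. \<bar>a\<bar> \<le> k \<and> \<bar>e - a * v\<bar> \<le> E"
proof (cases "\<bar>e\<bar> \<le> k * \<bar>v\<bar>")
  case True
  show ?thesis
  proof (cases "v = 0")
    case False
    then have "\<bar>e / v\<bar> \<le> k" using True by (simp add: divide_le_eq)
    then show ?thesis using False assms by (intro exI[of _ "e / v"]) auto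
  qed (use assms True in \<open>auto intro!: exI[of _ 0]\<close>)
next
  case False
  have "e - k * sgn e * sgn v * v = e - k * sgn e * \<bar>v\<bar>" by (simp add: abs_sgn ac_simps)
  also have "\<bar>\<dots>\<bar> \<le> E"
  proof (cases "e \<ge> 0")
    case True
    with assms False show ?thesis by (cases "e = 0") (auto simp: abs_le_iff)
  next
    case neg: False
    with assms False show ?thesis by (auto simp: abs_le_iff)
  qed
  finally have "\<bar>e - k * sgn e * sgn v * v\<bar> \<le> E" .
  moreover have "\<bar>k * sgn e * sgn v\<bar> \<le> k" using assms by (auto simp: abs_mult sgn_if)
  ultimately show ?thesis by blast
qed

lemma abs_scheme_le:
  assumes c: "c \<ge> 0" and d: "\<And>k y. k < n \<Longrightarrow> \<bar>d k y\<bar> * (1 + c)\<^sup>2 \<le> \<rho>"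
    and f: "\<And>y. \<bar>f y\<bar> \<le> B"
  shows "\<bar>scheme c d n f y\<bar> \<le> \<rho> ^ n * B"
  using d
proof (induction n arbitrary: y)
  case (Suc n)
  have B: "B \<ge> 0" using f[of 0] by linarith
  have IH: "\<bar>scheme c d n f z\<bar> \<le> \<rho> ^ n * B" for z using Suc by simp
  have "\<bar>smear 1 c (smear (-1) c (scheme c d n f)) y\<bar> \<le> (1 + c) * ((1 + c) * (\<rho> ^ n * B))"
    by (intro abs_smear_le c IH)
  then have "\<bar>scheme c d (Suc n) f y\<bar> \<le> \<bar>d n y\<bar> * ((1 + c) * ((1 + c) * (\<rho> ^ n * B)))"
    by (simp add: abs_mult mult_left_mono)
  also have "\<dots> = (\<bar>d n y\<bar> * (1 + c)\<^sup>2) * (\<rho> ^ n * B)" by (simp add: power2_eq_square)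
  also have "\<dots> \<le> \<rho> * (\<rho> ^ n * B)"
    using Suc.prems[of n y] order_trans[OF abs_ge_zero IH[of 0]] by (intro mult_right_mono) auto
  finally show ?case by (simp add: mult.assoc)
qed (simp add: f)

section \<open>Convergence of the splitting scheme and decrease of sign changes\<close>

context lattice_heat_flow
begin

text \<open>Rounds up the coefficient \<open>L + 5 / 4 * (M * (1 + K))\<close> of h^2 that arises in
  \<open>step_error\<close>.\<close>

definition C1 :: real where "C1 = L + 2 * M * (1 + K)"

lemma C1_nonneg: "C1 \<ge> 0"
  unfolding C1_def using L_nonneg M_nonneg K_nonneg by simp

text \<open>The multiplier is \<open>1 - h + a\<close>, where \<open>a\<close> absorbs the
  first-order part of the Euler error; what remains is of second order.\<close>

lemma step_error:
  assumes t: "0 \<le> t" "t + h \<le> T" and h: "0 < h" "h \<le> 1"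
  shows "\<exists>d. \<bar>d - (1 - h)\<bar> \<le> K * h \<and>
    \<bar>u (t + h) y - d * smear 1 (h / 2) (smear (-1) (h / 2) (u t)) y\<bar> \<le> C1 * h\<^sup>2"
proof -
  define v where "v = u t"
  define e where "e = u (t + h) y - v y - h / 2 * discrete_laplace v y"
  have "\<bar>e\<bar> \<le> K * h * \<bar>v y\<bar> + L * h\<^sup>2"
    using euler[of t "t + h" y] t h by (simp add: e_def v_def)
  then obtain a where a: "\<bar>a\<bar> \<le> K * h" "\<bar>e - a * v y\<bar> \<le> L * h\<^sup>2"
    using bounded_multiplier[of e "K * h" "v y" "L * h\<^sup>2"] K_nonneg L_nonneg h by auto
  have vM: "\<bar>v z\<bar> \<le> M" for z using u_bound t h by (simp add: v_def)
  \<comment> \<open>Expanding the product of the two smearings: the terms of order 0 and 1 cancel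
    apart from \<open>e - a * v y\<close>.\<close>
  have "u (t + h) y - (1 - h + a) * smear 1 (h / 2) (smear (-1) (h / 2) v) y =
      (e - a * v y) - ((a - h) * (h / 2)) * (v (y + 1) + v (y - 1)) - ((1 - h + a) * (h / 2)\<^sup>2) * v y"
    unfolding e_def smear_def discrete_laplace_def by (simp add: field_simps power2_eq_square)
  also have "\<bar>\<dots>\<bar> \<le> \<bar>e - a * v y\<bar> + \<bar>((a - h) * (h / 2)) * (v (y + 1) + v (y - 1))\<bar> +
      \<bar>((1 - h + a) * (h / 2)\<^sup>2) * v y\<bar>" by linarith
  also have "\<dots> \<le> L * h\<^sup>2 + ((1 + K) * h * (h / 2)) * (2 * M) + ((1 + K) * (h / 2)\<^sup>2) * M"
  proof (intro add_mono a(2))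
    have "\<bar>a - h\<bar> \<le> (1 + K) * h" using a(1) h by (simp add: algebra_simps)
    moreover have "\<bar>v (y + 1) + v (y - 1)\<bar> \<le> 2 * M" using vM[of "y + 1"] vM[of "y - 1"] by linarith
    ultimately show "\<bar>(a - h) * (h / 2) * (v (y + 1) + v (y - 1))\<bar> \<le> (1 + K) * h * (h / 2) * (2 * M)"
      using h K_nonneg by (simp only: abs_mult) (intro mult_mono, auto)
    have "K * h \<le> K" using h K_nonneg by (simp add: mult_left_le)
    then have "\<bar>1 - h + a\<bar> \<le> 1 + K" using a(1) h by linarith
    then show "\<bar>(1 - h + a) * (h / 2)\<^sup>2 * v y\<bar> \<le> (1 + K) * (h / 2)\<^sup>2 * M"
      using vM[of y] K_nonneg by (simp only: abs_mult) (intro mult_mono, auto)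
  qed
  also have "\<dots> = (L + 5 / 4 * (M * (1 + K))) * h\<^sup>2" by (simp add: field_simps power2_eq_square)
  also have "\<dots> \<le> C1 * h\<^sup>2"
    unfolding C1_def using mult_nonneg_nonneg[OF M_nonneg, of "1 + K"] K_nonneg by (intro mult_right_mono) auto
  finally have "\<bar>u (t + h) y - (1 - h + a) * smear 1 (h / 2) (smear (-1) (h / 2) v) y\<bar> \<le> C1 * h\<^sup>2" .
  then show ?thesis using a(1) by (intro exI[of _ "1 - h + a"]) (simp add: v_def)
qed

text \<open>Stability of one step: two smearings enlarge the sup norm by at most
  \<open>(1 + h / 2)^2\<close>, which is at most \<open>exp h\<close>, and the multiplier by at most
  \<open>exp (K * h)\<close>.\<close>

lemma multiplier_bound:
  assumes h: "0 \<le> h" "h \<le> 1" and d: "\<bar>d - (1 - h)\<bar> \<le> K * h"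
  shows "\<bar>d\<bar> * (1 + h / 2)\<^sup>2 \<le> exp ((K + 1) * h)"
proof -
  have "\<bar>d\<bar> \<le> 1 + K * h" using d h by linarith
  also have "\<dots> \<le> exp (K * h)" by (rule exp_ge_add_one_self)
  finally have 1: "\<bar>d\<bar> \<le> exp (K * h)" .
  have "(1 + h / 2)\<^sup>2 \<le> (exp (h / 2))\<^sup>2" using h by (intro power_mono) auto
  also have "\<dots> = exp h" by (simp add: power2_eq_square exp_add[symmetric])
  finally have "\<bar>d\<bar> * (1 + h / 2)\<^sup>2 \<le> exp (K * h) * exp h" using 1 by (intro mult_mono) auto
  then show ?thesis by (simp add: exp_add[symmetric] algebra_simps)
qed

text \<open>Consistency plus stability: each step adds a local error \<open>C1 * h^2\<close>, and
  earlier errors grow by the factor from \<open>multiplier_bound\<close>.\<close>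

lemma scheme_error:
  assumes s: "0 \<le> s" "s + real n * h \<le> T" and h: "0 < h" "h \<le> 1"
    and d: "\<And>k y. k < n \<Longrightarrow> \<bar>d k y - (1 - h)\<bar> \<le> K * h \<and>
      \<bar>u (s + real k * h + h) y - d k y * smear 1 (h / 2) (smear (-1) (h / 2) (u (s + real k * h))) y\<bar>
        \<le> C1 * h\<^sup>2"
  shows "\<bar>u (s + real n * h) y - scheme (h / 2) d n (u s) y\<bar> \<le> real n * (C1 * h\<^sup>2) * exp ((K + 1) * h) ^ n"
  using s(2) d
proof (induction n arbitrary: y)
  case (Suc n)
  let ?\<rho> = "exp ((K + 1) * h)" and ?E = "\<lambda>f. smear 1 (h / 2) (smear (-1) (h / 2) f)"
  let ?v = "u (s + real n * h)" and ?P = "scheme (h / 2) d n (u s)"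
  let ?\<epsilon> = "real n * (C1 * h\<^sup>2) * ?\<rho> ^ n"
  have \<rho>: "?\<rho> \<ge> 1" using K_nonneg h by simp
  \<comment> \<open>The difference is written with coefficients 1 and -1 to match
    \<open>smear_linear\<close>.\<close>
  have IH: "\<bar>1 * ?v z + (-1) * ?P z\<bar> \<le> ?\<epsilon>" for z
    using Suc.IH[of z] Suc.prems h by (simp add: algebra_simps)
  have "\<bar>?E (\<lambda>z. 1 * ?v z + (-1) * ?P z) y\<bar> \<le> (1 + h / 2) * ((1 + h / 2) * ?\<epsilon>)"
    using h by (intro abs_smear_le IH) auto
  then have "\<bar>?E ?v y - ?E ?P y\<bar> \<le> (1 + h / 2) * ((1 + h / 2) * ?\<epsilon>)"
    unfolding smear_linear by simp
  then have "\<bar>d n y * ?E ?v y - d n y * ?E ?P y\<bar> \<le> \<bar>d n y\<bar> * ((1 + h / 2) * ((1 + h / 2) * ?\<epsilon>))"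
    unfolding right_diff_distrib[symmetric] abs_mult by (intro mult_left_mono) auto
  also have "\<dots> = \<bar>d n y\<bar> * (1 + h / 2)\<^sup>2 * ?\<epsilon>" by (simp add: power2_eq_square)
  also have "\<dots> \<le> ?\<rho> * ?\<epsilon>"
    using multiplier_bound[of h "d n y"] Suc.prems(2)[of n y] h C1_nonneg by (intro mult_right_mono) auto
  finally have 1: "\<bar>d n y * ?E ?v y - d n y * ?E ?P y\<bar> \<le> ?\<rho> * ?\<epsilon>" .
  have "\<bar>u (s + real n * h + h) y - d n y * ?E ?v y\<bar> \<le> C1 * h\<^sup>2" using Suc.prems(2)[of n y] by simp
  also have "\<dots> \<le> C1 * h\<^sup>2 * ?\<rho> ^ Suc n"
    using mult_left_mono[OF one_le_power[OF \<rho>, of "Suc n"], of "C1 * h\<^sup>2"] C1_nonneg by simp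
  finally have "\<bar>u (s + real n * h + h) y - d n y * ?E ?P y\<bar> \<le> C1 * h\<^sup>2 * ?\<rho> ^ Suc n + ?\<rho> * ?\<epsilon>"
    using 1 by linarith
  also have "\<dots> = real (Suc n) * (C1 * h\<^sup>2) * ?\<rho> ^ Suc n" by (simp add: algebra_simps)
  also have "s + real n * h + h = s + real (Suc n) * h" by (simp add: algebra_simps)
  finally show ?case by simp
qed simp

text \<open>With \<open>n\<close> steps of size \<open>(t - s) / n\<close>, the accumulated local
  errors are of order \<open>1 / n\<close>, while the growth factor stays bounded.\<close>

lemma scheme_converges:
  assumes st: "0 \<le> s" "s < t" "t \<le> T"
  obtains d :: "nat \<Rightarrow> nat \<Rightarrow> int \<Rightarrow> real" where
    "\<And>n k y. n > 0 \<Longrightarrow> (t - s) / n \<le> 1 \<Longrightarrow> k < n \<Longrightarrow> \<bar>d n k y - (1 - (t - s) / n)\<bar> \<le> K * ((t - s) / n)"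
    "\<And>y. (\<lambda>n. scheme ((t - s) / n / 2) (d n) n (u s) y) \<longlonglongrightarrow> u t y"
proof -
  define h where "h n = (t - s) / real n" for n
  have ex: "\<exists>d. \<bar>d - (1 - h n)\<bar> \<le> K * h n \<and>
      \<bar>u (s + real k * h n + h n) y - d * smear 1 (h n / 2) (smear (-1) (h n / 2) (u (s + real k * h n))) y\<bar>
        \<le> C1 * (h n)\<^sup>2" if n: "n > 0" "h n \<le> 1" "k < n" for n k y
  proof (rule step_error)
    have h0: "0 < h n" using n st by (simp add: h_def)
    show "0 < h n" "h n \<le> 1" by fact+
    show "0 \<le> s + real k * h n" using st h0 by simp
    have "(real k + 1) * h n \<le> real n * h n" using n h0 by (intro mult_right_mono) auto
    also have "\<dots> = t - s" using n by (simp add: h_def)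
    finally show "s + real k * h n + h n \<le> T" using st by (simp add: algebra_simps)
  qed
  \<comment> \<open>The multipliers are chosen from the values of \<open>u\<close> itself; they are
    meaningful once the step size is at most 1.\<close>
  define d where "d n k y = (SOME d. \<bar>d - (1 - h n)\<bar> \<le> K * h n \<and>
      \<bar>u (s + real k * h n + h n) y - d * smear 1 (h n / 2) (smear (-1) (h n / 2) (u (s + real k * h n))) y\<bar>
        \<le> C1 * (h n)\<^sup>2)" for n k y
  have d: "\<bar>d n k y - (1 - h n)\<bar> \<le> K * h n \<and>
      \<bar>u (s + real k * h n + h n) y - d n k y * smear 1 (h n / 2) (smear (-1) (h n / 2) (u (s + real k * h n))) y\<bar>
        \<le> C1 * (h n)\<^sup>2" if "n > 0" "h n \<le> 1" "k < n" for n k y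
    unfolding d_def by (rule someI_ex[OF ex[OF that]])
  have "(\<lambda>n. scheme (h n / 2) (d n) n (u s) y) \<longlonglongrightarrow> u t y" for y
  proof -
    have "(\<lambda>n. h n) \<longlonglongrightarrow> 0" unfolding h_def by (rule lim_const_over_n)
    then have "\<forall>\<^sub>F n in sequentially. h n < 1" by (rule order_tendstoD) simp
    moreover have "\<forall>\<^sub>F n in sequentially. n > 0" by (rule eventually_gt_at_top)
    ultimately have "\<forall>\<^sub>F n in sequentially.
       norm (scheme (h n / 2) (d n) n (u s) y - u t y) \<le> C1 * (t - s)\<^sup>2 * exp ((K + 1) * (t - s)) / real n"
    proof eventually_elim
      case (elim n)
      have nh: "real n * h n = t - s" using elim by (simp add: h_def)
      have "\<bar>u (s + real n * h n) y - scheme (h n / 2) (d n) n (u s) y\<bar>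
          \<le> real n * (C1 * (h n)\<^sup>2) * exp ((K + 1) * h n) ^ n"
        using elim st d nh by (intro scheme_error) (auto simp: h_def)
      also have "exp ((K + 1) * h n) ^ n = exp ((K + 1) * (t - s))"
        by (simp add: exp_of_nat_mult[symmetric] nh[symmetric] ac_simps)
      also have "real n * (C1 * (h n)\<^sup>2) = C1 * (t - s)\<^sup>2 / real n"
        using elim by (simp add: h_def power2_eq_square)
      finally show ?case by (simp add: nh abs_minus_commute)
    qed
    moreover have "(\<lambda>n. C1 * (t - s)\<^sup>2 * exp ((K + 1) * (t - s)) / real n) \<longlonglongrightarrow> 0"
      by (rule lim_const_over_n)
    ultimately have "(\<lambda>n. scheme (h n / 2) (d n) n (u s) y - u t y) \<longlonglongrightarrow> 0"
      by (rule Lim_null_comparison)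
    then show ?thesis by (rule LIM_zero_cancel)
  qed
  then show thesis using d that[of d] by (simp add: h_def)
qed

lemma multiplier_ge:
  assumes "\<bar>d - (1 - h)\<bar> \<le> K * h"
  shows "1 - (1 + K) * h \<le> d"
  using assms by (simp add: algebra_simps)

text \<open>With \<open>h = x / n\<close>, the middle condition makes all multipliers at least 1/2,
  by \<open>multiplier_ge\<close>.\<close>

lemma eventually_small: "\<forall>\<^sub>F n in sequentially. n > 0 \<and> (1 + K) * (x / real n) \<le> 1 / 2 \<and> x / real n \<le> 1"
proof -
  have "(\<lambda>n. (1 + K) * (x / real n)) \<longlonglongrightarrow> 0" "(\<lambda>n. x / real n) \<longlonglongrightarrow> 0"
    using lim_const_over_n[of "(1 + K) * x"] by (auto intro: lim_const_over_n)
  from order_tendstoD(2)[OF this(1), of "1/2"] order_tendstoD(2)[OF this(2), of 1]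
  have "\<forall>\<^sub>F n in sequentially. (1 + K) * (x / real n) < 1 / 2" "\<forall>\<^sub>F n in sequentially. x / real n < 1"
    by simp_all
  with eventually_gt_at_top[of "0::nat"] show ?thesis by eventually_elim simp
qed

text \<open>Sign changes of \<open>u t\<close> already occur in a single approximation with positive
  multipliers and are traced back through its finitely many steps to \<open>u s\<close>.\<close>

lemma alternates_decreasing:
  assumes st: "0 \<le> s" "s \<le> t" "t \<le> T" and alt: "alternates (u t) N"
  shows "alternates (u s) N"
proof (cases "s = t")
  case False
  with st have "s < t" by simp
  obtain d where d: "\<And>n k y. n > 0 \<Longrightarrow> (t - s) / n \<le> 1 \<Longrightarrow> k < n \<Longrightarrow>
        \<bar>d n k y - (1 - (t - s) / n)\<bar> \<le> K * ((t - s) / n)"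
    and lim: "\<And>y. (\<lambda>n. scheme ((t - s) / n / 2) (d n) n (u s) y) \<longlonglongrightarrow> u t y"
    using scheme_converges[OF st(1) \<open>s < t\<close> st(3)] by blast
  obtain n where n: "alternates (scheme ((t - s) / n / 2) (d n) n (u s)) N" "n > 0"
      "(1 + K) * ((t - s) / real n) \<le> 1 / 2" "(t - s) / real n \<le> 1"
    using eventually_conj[OF alternates_limit[OF lim alt] eventually_small[of "t - s"]]
    using eventually_happens'[OF sequentially_bot] by blast
  have "d n k y > 0" if "k < n" for k y
    using multiplier_ge[OF d[OF n(2,4) that, of y]] n(3) by linarith
  moreover have "(t - s) / real n / 2 \<ge> 0" using st by simp
  ultimately show ?thesis using alternates_scheme[OF _ _ n(1)] by blast
qed (use alt in simp)

end

section \<open>Kernel estimates\<close>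

text \<open>Consecutive binomial coefficients have ratio \<open>(n - j) / (j + 1)\<close>, at most
  \<open>n / (j + 1)\<close>. Later \<open>c * n\<close> is \<open>t / 2\<close>, so the estimate is
  uniform in \<open>n\<close>.\<close>

lemma binomial_ratio:
  fixes c r :: real
  assumes "c \<ge> 0" "c * real n \<le> r * real (Suc j)"
  shows "real (n choose Suc j) * c ^ Suc j \<le> r * (real (n choose j) * c ^ j)"
proof -
  have "Suc j * (n choose Suc j) = (n - j) * (n choose j)"
    using binomial_absorption[of j n] binomial_absorb_comp[of n j] by simp
  also have "\<dots> \<le> n * (n choose j)" by simp
  finally have "real (Suc j * (n choose Suc j)) \<le> real (n * (n choose j))" by (rule of_nat_mono)
  then have le: "real (Suc j) * real (n choose Suc j) \<le> real n * real (n choose j)"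
    by (simp only: of_nat_mult)
  have "real (Suc j) * (real (n choose Suc j) * c ^ Suc j) =
      (real (Suc j) * real (n choose Suc j)) * c ^ Suc j" by (simp only: mult.assoc)
  also have "\<dots> \<le> (real n * real (n choose j)) * c ^ Suc j"
    using le assms(1) by (intro mult_right_mono) auto
  also have "\<dots> = (c * real n) * (real (n choose j) * c ^ j)" by (simp add: ac_simps)
  also have "\<dots> \<le> (r * real (Suc j)) * (real (n choose j) * c ^ j)"
    using assms by (intro mult_right_mono) auto
  also have "\<dots> = real (Suc j) * (r * (real (n choose j) * c ^ j))" by (simp only: ac_simps)
  finally show ?thesis by (rule mult_left_le_imp_le) simp
qed

text \<open>A geometric-series bound: the tail \<open>S\<close> satisfies
  \<open>S \<le> r * (b m + S)\<close>, which is solved for \<open>S\<close> using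
  \<open>r \<le> 1 / 2\<close>.\<close>

lemma binomial_tail_le:
  fixes c r :: real
  assumes c: "c \<ge> 0" "c * real n \<le> r * real (Suc m)" and r: "0 \<le> r" "r \<le> 1 / 2"
  shows "(\<Sum>j=Suc m..n. real (n choose j) * c ^ j) \<le> 2 * r * (real (n choose m) * c ^ m)"
proof (cases "m \<le> n")
  case True
  define b where "b j = real (n choose j) * c ^ j" for j
  define S where "S = (\<Sum>j=Suc m..n. b j)"
  have b0: "b j \<ge> 0" for j using c by (simp add: b_def)
  have S0: "S \<ge> 0" unfolding S_def by (intro sum_nonneg b0)
  have ratio: "b (Suc j) \<le> r * b j" if "j \<ge> m" for j
  proof -
    have "r * real (Suc m) \<le> r * real (Suc j)" using that r by (intro mult_left_mono) auto
    then show ?thesis unfolding b_def using c by (intro binomial_ratio) auto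
  qed
  have "S = (\<Sum>j=m..<n. b (Suc j))"
    unfolding S_def atLeastLessThanSuc_atLeastAtMost[symmetric] by (rule sum.shift_bounds_Suc_ivl)
  also have "\<dots> \<le> (\<Sum>j=m..<n. r * b j)" by (intro sum_mono ratio) auto
  also have "\<dots> = r * (\<Sum>j=m..<n. b j)" by (simp add: sum_distrib_left)
  also have "(\<Sum>j=m..<n. b j) \<le> (\<Sum>j=m..n. b j)" by (intro sum_mono2 b0) auto
  also have "(\<Sum>j=m..n. b j) = b m + S" unfolding S_def by (rule sum.atLeast_Suc_atMost[OF True])
  finally have "S \<le> r * (b m + S)" using r by (simp add: mult_left_mono)
  then have "S \<le> r * b m + r * S" by (simp add: distrib_left)
  moreover have "r * S \<le> 1 / 2 * S" using r S0 by (intro mult_right_mono)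
  ultimately have "S \<le> 2 * (r * b m)" by linarith
  then show ?thesis by (simp add: S_def b_def)
qed (use assms in simp)

text \<open>The direction -1 reads only points further left, so on a left half-line of nonpositive
  values it only adds nonpositive terms.\<close>

lemma smear_power_le_of_nonpos:
  assumes "c \<ge> 0" "\<And>x. x \<le> y \<Longrightarrow> f x \<le> 0" "x \<le> y"
  shows "(smear (-1) c ^^ n) f x \<le> f x"
  using assms(3)
proof (induction n arbitrary: x)
  case (Suc n)
  let ?g = "(smear (-1) c ^^ n) f"
  have "?g (x - 1) \<le> f (x - 1)" "f (x - 1) \<le> 0" using Suc assms(2) by auto
  then have "c * ?g (x - 1) \<le> 0" using assms(1) by (simp add: mult_nonneg_nonpos)
  then show ?case using Suc.IH[OF Suc.prems] by (simp add: smear_def[of _ _ ?g])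
qed simp

text \<open>The weight that \<open>(smear 1 c)^n\<close> gives to a distance \<open>j\<close> decays superexponentially in \<open>j\<close>, so
  far to the left the unit mass at \<open>a\<close> outweighs everything to the right of \<open>a\<close>.\<close>

lemma smear_both_barrier:
  assumes c: "c \<ge> 0" "c * real n \<le> r * real (Suc m)" and r: "0 \<le> r" "r \<le> 1 / 2"
    and P: "0 \<le> P" "2 * r * P \<le> Q / 2" and ab: "a < b"
  shows "smear_both n c (\<lambda>y. P * of_bool (b \<le> y) + (- Q) * of_bool (y = a)) (a - int m)
    \<le> - (Q / 2) * (real (n choose m) * c ^ m)"
proof -
  define g where "g y = P * of_bool (b \<le> y) + (- Q) * of_bool (y = a)" for y
  have Q: "Q \<ge> 0" using P r mult_nonneg_nonneg[of "2 * r" P] by linarith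
  \<comment> \<open>A bound for all \<open>k \<ge> m\<close> is required because the smearing in
    direction -1 reads points to the left of \<open>a - int m\<close>.\<close>
  have T: "(smear 1 c ^^ n) g (a - int k) \<le> - (Q / 2) * (real (n choose k) * c ^ k)" if "k \<ge> m" for k
  proof -
    define w where "w j = real (n choose j) * c ^ j" for j
    have w0: "w j \<ge> 0" for j using c by (simp add: w_def)
    have *: "(smear 1 c ^^ n) g (a - int k) = (\<Sum>j\<le>n. w j * g (a - int k + int j))"
      by (simp add: smear_power_eq_sum w_def)
    \<comment> \<open>Displacements below \<open>k\<close> end to the left of \<open>a\<close>,
      where \<open>g\<close> vanishes.\<close>
    have left: "w j * g (a - int k + int j) = 0" if "j < k" for j
      using that ab by (simp add: g_def)
    show ?thesis
    proof (cases "k \<le> n")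
      case True
      have split: "{..n} = {..<k} \<union> {k..n}" "{..<k} \<inter> {k..n} = {}" using True by auto
      have "(\<Sum>j\<le>n. w j * g (a - int k + int j)) = (\<Sum>j=k..n. w j * g (a - int k + int j))"
        unfolding split(1) by (subst sum.union_disjoint) (auto simp: left)
      also have "\<dots> = w k * g (a - int k + int k) + (\<Sum>j=Suc k..n. w j * g (a - int k + int j))"
        by (rule sum.atLeast_Suc_atMost[OF True])
      also have "g (a - int k + int k) = - Q" using ab by (simp add: g_def)
      also have "(\<Sum>j=Suc k..n. w j * g (a - int k + int j)) \<le> (\<Sum>j=Suc k..n. w j * P)"
        using P Q by (intro sum_mono mult_left_mono w0) (auto simp: g_def)
      also have "(\<Sum>j=Suc k..n. w j * P) = P * (\<Sum>j=Suc k..n. w j)"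
        by (simp add: sum_distrib_left mult.commute)
      also have "(\<Sum>j=Suc k..n. w j) \<le> 2 * r * w k"
      proof -
        have "r * real (Suc m) \<le> r * real (Suc k)" using \<open>k \<ge> m\<close> r by (intro mult_left_mono) auto
        then show ?thesis unfolding w_def using c r by (intro binomial_tail_le) auto
      qed
      finally have "(\<Sum>j\<le>n. w j * g (a - int k + int j)) \<le> w k * - Q + P * (2 * r * w k)"
        using P by (simp add: mult_left_mono)
      also have "\<dots> = (2 * r * P - Q) * w k" by (simp add: algebra_simps)
      also have "\<dots> \<le> - (Q / 2) * w k" using P by (intro mult_right_mono w0) auto
      finally show ?thesis unfolding * by (simp add: w_def)
    next
      case False
      then have "(\<Sum>j\<le>n. w j * g (a - int k + int j)) = 0" by (intro sum.neutral) (auto simp: left)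
      with False show ?thesis unfolding * by (simp add: binomial_eq_0)
    qed
  qed
  have nonpos: "(smear 1 c ^^ n) g x \<le> 0" if "x \<le> a - int m" for x
  proof -
    have "(smear 1 c ^^ n) g x \<le> - (Q / 2) * (real (n choose nat (a - x)) * c ^ nat (a - x))"
      using T[of "nat (a - x)"] that by simp
    also have "\<dots> \<le> 0" using Q c by (intro mult_nonpos_nonneg mult_nonneg_nonneg) auto
    finally show ?thesis .
  qed
  have "smear_both n c g (a - int m) \<le> (smear 1 c ^^ n) g (a - int m)"
    unfolding smear_both_def using c(1) nonpos order_refl by (rule smear_power_le_of_nonpos)
  also have "\<dots> \<le> - (Q / 2) * (real (n choose m) * c ^ m)" by (rule T) simp
  finally show ?thesis by (simp add: g_def[abs_def])
qed

text \<open>Since \<open>(n / m)^m\<close> is at most \<open>n choose m\<close>, the powers of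
  \<open>n\<close> cancel and the lower bound survives the limit in \<open>n\<close>. For
  \<open>m = 0\<close> both sides are 1.\<close>

lemma binomial_weight_ge:
  assumes "x \<ge> 0" "m \<le> n" "n > 0"
  shows "(x / (2 * real m)) ^ m \<le> real (n choose m) * (x / real n / 2) ^ m"
proof (cases "m = 0")
  case False
  have "(x / (2 * real m)) ^ m = (real n / real m) ^ m * (x / real n / 2) ^ m"
    unfolding power_mult_distrib[symmetric] using assms False by (simp add: field_simps)
  also have "\<dots> \<le> real (n choose m) * (x / real n / 2) ^ m"
    using binomial_ge_n_over_k_pow_k[OF assms(2), where 'a = real] assms by (intro mult_right_mono) auto
  finally show ?thesis .
qed simp

text \<open>On \<open>[0, 1/2]\<close> one has \<open>(1 - z) * (1 + 2 * z) \<ge> 1\<close>, hence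
  \<open>1 - z \<ge> exp (- (2 * z))\<close>.\<close>

lemma exp_le_power_one_minus:
  fixes x :: real
  assumes "n > 0" "x \<ge> 0" "x / real n \<le> 1 / 2"
  shows "exp (- (2 * x)) \<le> (1 - x / real n) ^ n"
proof -
  define z where "z = x / real n"
  have z: "0 \<le> z" "z \<le> 1 / 2" using assms by (auto simp: z_def)
  have "0 \<le> z * (1 - 2 * z)" using z by simp
  then have "1 \<le> (1 - z) * (1 + 2 * z)" by (simp add: algebra_simps)
  also have "\<dots> \<le> (1 - z) * exp (2 * z)" using z by (intro mult_left_mono exp_ge_add_one_self) auto
  finally have "exp (- (2 * z)) \<le> 1 - z" by (simp add: exp_minus field_simps)
  then have "exp (- (2 * z)) ^ n \<le> (1 - z) ^ n" by (intro power_mono) auto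
  moreover have "exp (- (2 * z)) ^ n = exp (- (2 * x))"
    using assms by (simp add: exp_of_nat_mult[symmetric] z_def)
  ultimately show ?thesis by (simp add: z_def)
qed

section \<open>Signs of the solution far away and between\<close>

context lattice_heat_flow
begin

text \<open>The multipliers lie between \<open>1 - (1 + K) * h\<close> and \<open>1 + K * h\<close>;
  their \<open>n\<close>-th powers are replaced by constants independent of
  \<open>n\<close>.\<close>

lemma scheme_bounds:
  assumes t: "0 \<le> t" and n: "n > 0" "(1 + K) * (t / real n) \<le> 1 / 2" "t / real n \<le> 1"
    and d: "\<And>k y. k < n \<Longrightarrow> \<bar>d k y - (1 - t / real n)\<bar> \<le> K * (t / real n)"
    and f: "\<And>y. f y \<ge> 0"
  shows "exp (- (2 * ((1 + K) * t))) * smear_both n (t / n / 2) f y \<le> scheme (t / n / 2) d n f y"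
    and "scheme (t / n / 2) d n f y \<le> exp (K * t) * smear_both n (t / n / 2) f y"
proof -
  define h where "h = t / real n"
  have h: "h \<ge> 0" "h \<le> 1" "(1 + K) * h \<le> 1 / 2" using t n by (auto simp: h_def)
  let ?\<alpha> = "1 - (1 + K) * h" and ?\<beta> = "1 + K * h"
  have W: "smear_both n (h / 2) f y \<ge> 0" using h f by (intro smear_both_nonneg) auto
  have "?\<alpha> \<le> d k y \<and> d k y \<le> ?\<beta>" if "k < n" for k y
    using d[OF that, of y] h by (auto simp: h_def[symmetric] algebra_simps)
  then have b: "?\<alpha> ^ n * smear_both n (h / 2) f y \<le> scheme (h / 2) d n f y \<and>
     scheme (h / 2) d n f y \<le> ?\<beta> ^ n * smear_both n (h / 2) f y"
    using h f by (intro scheme_between) auto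
  have "exp (- (2 * ((1 + K) * t))) \<le> (1 - (1 + K) * t / real n) ^ n"
    using n t K_nonneg by (intro exp_le_power_one_minus) auto
  then have "exp (- (2 * ((1 + K) * t))) * smear_both n (h / 2) f y \<le> ?\<alpha> ^ n * smear_both n (h / 2) f y"
    using W by (intro mult_right_mono) (auto simp: h_def)
  then show "exp (- (2 * ((1 + K) * t))) * smear_both n (t / n / 2) f y \<le> scheme (t / n / 2) d n f y"
    using b by (simp add: h_def)
  have "?\<beta> ^ n \<le> exp (K * h) ^ n"
    using K_nonneg h by (intro power_mono exp_ge_add_one_self) auto
  also have "\<dots> = exp (K * t)" using n by (simp add: exp_of_nat_mult[symmetric] h_def)
  finally have "?\<beta> ^ n * smear_both n (h / 2) f y \<le> exp (K * t) * smear_both n (h / 2) f y"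
    using W by (intro mult_right_mono)
  then show "scheme (t / n / 2) d n f y \<le> exp (K * t) * smear_both n (t / n / 2) f y"
    using b by (simp add: h_def)
qed

text \<open>Keeps only the binomial term that leads straight from \<open>y\<close> to
  \<open>b\<close> in \<open>m\<close> unit steps. The bound does not depend on
  \<open>n\<close>.\<close>

lemma scheme_point_mass_ge:
  assumes t: "0 \<le> t" and n: "n > 0" "(1 + K) * (t / real n) \<le> 1 / 2" "t / real n \<le> 1"
    and d: "\<And>k y. k < n \<Longrightarrow> \<bar>d k y - (1 - t / real n)\<bar> \<le> K * (t / real n)"
    and m: "m = nat \<bar>y - b\<bar>" "m \<le> n"
  shows "exp (- (2 * ((1 + K) * t))) * (t / (2 * real m)) ^ m
    \<le> scheme (t / n / 2) d n (\<lambda>y. of_bool (y = b)) y"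
proof -
  define \<sigma> :: int where "\<sigma> = (if y \<le> b then 1 else -1)"
  let ?c = "t / n / 2" and ?f = "\<lambda>y. of_bool (y = b) :: real"
  have c: "?c \<ge> 0" using t by simp
  have "(t / (2 * real m)) ^ m \<le> real (n choose m) * ?c ^ m"
    using t m n by (intro binomial_weight_ge) auto
  also have "\<dots> = real (n choose m) * ?c ^ m * ?f (y + int m * \<sigma>)"
    using m by (simp add: \<sigma>_def)
  also have "\<dots> \<le> (\<Sum>j\<le>n. real (n choose j) * ?c ^ j * ?f (y + int j * \<sigma>))"
    using m c by (intro member_le_sum) auto
  also have "\<dots> = (smear \<sigma> ?c ^^ n) ?f y" by (simp add: smear_power_eq_sum)
  also have "\<dots> \<le> smear_both n ?c ?f y"
    using c by (intro smear_both_ge_power) (auto simp: \<sigma>_def)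
  finally have "exp (- (2 * ((1 + K) * t))) * (t / (2 * real m)) ^ m
      \<le> exp (- (2 * ((1 + K) * t))) * smear_both n ?c ?f y" by (intro mult_left_mono) auto
  also have "\<dots> \<le> scheme ?c d n ?f y" by (rule scheme_bounds[OF t n d]) auto
  finally show ?thesis .
qed

lemma scheme_point_mass_le:
  assumes t: "0 \<le> t" and n: "n > 0" "t / real n \<le> 1"
    and d: "\<And>k y. k < n \<Longrightarrow> \<bar>d k y - (1 - t / real n)\<bar> \<le> K * (t / real n)"
  shows "scheme (t / n / 2) d n (\<lambda>y. of_bool (y = b)) y \<le> exp ((K + 1) * t)"
proof -
  have "\<bar>scheme (t / n / 2) d n (\<lambda>y. of_bool (y = b)) y\<bar> \<le> exp ((K + 1) * (t / n)) ^ n * 1"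
    using t n multiplier_bound[OF _ n(2) d] by (intro abs_scheme_le) auto
  also have "exp ((K + 1) * (t / n)) ^ n = exp ((K + 1) * t)"
    using n by (simp add: exp_of_nat_mult[symmetric])
  finally show ?thesis by simp
qed

text \<open>The initial datum lies below \<open>M\<close> times the indicator of
  \<open>b \<le> y\<close> plus the negative mass at \<open>a\<close>. Comparing both parts with the
  flow without potential reduces the claim to \<open>smear_both_barrier\<close>.\<close>

lemma negative_far_left:
  assumes t: "0 < t" "t \<le> T" and pos: "\<And>y. u 0 y > 0 \<Longrightarrow> b \<le> y" and neg: "u 0 a < 0" and ab: "a < b"
  shows "\<exists>y\<le>z. u t y < 0"
proof -
  \<comment> \<open>The positive part gets the largest possible effect of the multipliers, the
    negative mass the smallest.\<close>
  define P where "P = exp (K * t) * M"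
  define Q where "Q = exp (- (2 * ((1 + K) * t))) * (- u 0 a)"
  have P: "P \<ge> 0" using M_nonneg by (simp add: P_def)
  have Q: "Q > 0" unfolding Q_def using neg by (intro mult_pos_pos) auto
  \<comment> \<open>Chosen so that \<open>2 * R * P \<le> Q / 2\<close>, as the barrier
    requires.\<close>
  define R where "R = min (1 / 2) (Q / (4 * (P + 1)))"
  have R: "R > 0" using P Q by (auto simp: R_def)
  have R_half: "R \<le> 1 / 2" unfolding R_def by (rule min.cobounded1)
  have "2 * R * P \<le> 2 * (Q / (4 * (P + 1))) * (P + 1)"
    using P Q R by (intro mult_mono) (auto simp: R_def)
  also have "\<dots> = Q / 2" using P by (simp add: field_simps)
  finally have RPQ: "2 * R * P \<le> Q / 2" .
  \<comment> \<open>The first condition bounds the weight ratios beyond distance \<open>m\<close> by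
    \<open>R\<close>; the last puts \<open>a - int m\<close> at or to the left of
    \<open>z\<close>.\<close>
  obtain m where m: "real m > t / (2 * R)" "m > 0" "m \<ge> nat (a - z)"
  proof -
    obtain m0 where "real m0 > t / (2 * R)" using reals_Archimedean2 by blast
    then show thesis using that[of "m0 + nat (a - z) + 1"] by simp
  qed
  have Rm: "t / 2 \<le> R * real (Suc m)" using m(1) R by (simp add: field_simps)
  obtain d where d: "\<And>n k y. n > 0 \<Longrightarrow> (t - 0) / n \<le> 1 \<Longrightarrow> k < n \<Longrightarrow>
        \<bar>d n k y - (1 - (t - 0) / n)\<bar> \<le> K * ((t - 0) / n)"
    and lim: "\<And>y. (\<lambda>n. scheme ((t - 0) / n / 2) (d n) n (u 0) y) \<longlonglongrightarrow> u t y"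
    using scheme_converges[OF order_refl t] by blast
  let ?y = "a - int m"
  let ?p = "\<lambda>y. of_bool (b \<le> y) :: real" and ?q = "\<lambda>y. of_bool (y = a) :: real"
  \<comment> \<open>Independent of \<open>n\<close>, so strict negativity survives the
    limit.\<close>
  let ?bound = "- (Q / 2) * (t / (2 * real m)) ^ m"
  have "\<forall>\<^sub>F n in sequentially. scheme ((t - 0) / n / 2) (d n) n (u 0) ?y \<le> ?bound"
    using eventually_small[of t] eventually_ge_at_top[of m]
  proof eventually_elim
    case (elim n)
    let ?c = "t / n / 2"
    have c: "?c \<ge> 0" using t by simp
    have dn: "\<bar>d n k y - (1 - t / n)\<bar> \<le> K * (t / n)" if "k < n" for k y
      using d[of n k y] elim that by simp
    have d0: "d n k y \<ge> 0" if "k < n" for k y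
      using multiplier_ge[OF dn[OF that, of y]] elim by linarith
    have t0: "0 \<le> t" using t by simp
    note bounds = scheme_bounds[of t n "d n", OF t0 _ _ _ dn]
    have u0: "u 0 y \<le> M * ?p y + u 0 a * ?q y" for y
    proof (cases "b \<le> y")
      case False
      then have "u 0 y \<le> 0" using pos[of y] by linarith
      then show ?thesis using False by (cases "y = a") auto
    qed (use u_bound[of 0 y] t ab in auto)
    have "scheme ?c (d n) n (u 0) ?y \<le> scheme ?c (d n) n (\<lambda>y. M * ?p y + u 0 a * ?q y) ?y"
      by (rule scheme_mono[OF c d0 u0])
    also have "\<dots> = M * scheme ?c (d n) n ?p ?y + u 0 a * scheme ?c (d n) n ?q ?y"
      by (simp only: scheme_linear)
    also have "\<dots> \<le> M * (exp (K * t) * smear_both n ?c ?p ?y) +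
        u 0 a * (exp (- (2 * ((1 + K) * t))) * smear_both n ?c ?q ?y)"
      using elim M_nonneg neg
      by (intro add_mono mult_left_mono mult_left_mono_neg bounds) auto
    also have "\<dots> = P * smear_both n ?c ?p ?y + (- Q) * smear_both n ?c ?q ?y"
      by (simp add: P_def Q_def)
    also have "\<dots> = smear_both n ?c (\<lambda>y. P * ?p y + (- Q) * ?q y) ?y"
      by (simp only: smear_both_linear)
    also have "\<dots> \<le> - (Q / 2) * (real (n choose m) * ?c ^ m)"
      using R R_half Rm RPQ P ab c elim by (intro smear_both_barrier[where r = R]) auto
    also have "\<dots> \<le> ?bound"
      using binomial_weight_ge[of t m n] Q t elim by (intro mult_left_mono_neg) auto
    finally show ?case by simp
  qed
  then have "u t ?y \<le> ?bound" by (rule tendsto_upperbound[OF lim]) simp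
  also have "?bound < 0" using Q t m by simp
  finally have "u t ?y < 0" .
  then show ?thesis using m(3) by (intro exI[of _ ?y]) auto
qed

text \<open>If \<open>u t y \<ge> 0\<close> for some \<open>y\<close> to the left of a point where \<open>u t\<close> is negative, a small positive
  mass added to the initial datum at \<open>b\<close> makes the solution positive at \<open>y\<close>. It then has two sign
  changes, although the perturbed initial datum still has only one. The perturbation is made at the
  level of the scheme, so that no existence theorem for solutions is needed.\<close>

lemma negative_down_closed:
  assumes t: "0 < t" "t \<le> T" and pos: "\<And>y. u 0 y > 0 \<longleftrightarrow> b \<le> y" and neg: "\<And>y. u 0 y < 0 \<longleftrightarrow> y \<le> a"
    and ab: "a < b" and z: "u t z < 0" and yz: "y < z"
  shows "u t y < 0"
proof (rule ccontr)
  assume "\<not> u t y < 0"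
  then have y: "u t y \<ge> 0" by simp
  obtain x where x: "x \<le> y - 1" "u t x < 0"
    using negative_far_left[OF t, of b a "y - 1"] pos neg ab by auto
  define C where "C = exp ((K + 1) * t)"
  \<comment> \<open>Half of the margin \<open>v\<close> is spent on the approximation error at
    \<open>x\<close> and \<open>z\<close>, the other half on the added mass.\<close>
  define v where "v = min (- u t x) (- u t z)"
  have v: "v > 0" using x z by (simp add: v_def)
  define \<epsilon> where "\<epsilon> = v / (2 * C)"
  have C: "C > 0" by (simp add: C_def)
  have \<epsilon>: "\<epsilon> > 0" "\<epsilon> * C = v / 2" using v C by (auto simp: \<epsilon>_def)
  define m where "m = nat \<bar>y - b\<bar>"
  \<comment> \<open>A lower bound, uniform in \<open>n\<close>, for the mass arriving at
    \<open>y\<close>; the approximation error there is kept below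
    \<open>\<epsilon> * \<eta>\<close>.\<close>
  define \<eta> where "\<eta> = exp (- (2 * ((1 + K) * t))) * (t / (2 * real m)) ^ m"
  have \<eta>: "\<eta> > 0" using t by (cases "m = 0") (auto simp: \<eta>_def)
  obtain d where d: "\<And>n k y. n > 0 \<Longrightarrow> (t - 0) / n \<le> 1 \<Longrightarrow> k < n \<Longrightarrow>
        \<bar>d n k y - (1 - (t - 0) / n)\<bar> \<le> K * ((t - 0) / n)"
    and lim: "\<And>y. (\<lambda>n. scheme ((t - 0) / n / 2) (d n) n (u 0) y) \<longlonglongrightarrow> u t y"
    using scheme_converges[OF order_refl t] by blast
  let ?P = "\<lambda>n. scheme (t / real n / 2) (d n) n" and ?\<delta> = "\<lambda>y. of_bool (y = b) :: real"
  have lim': "(\<lambda>n. ?P n (u 0) w) \<longlonglongrightarrow> u t w" for w using lim[of w] by simp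
  have "\<forall>\<^sub>F n in sequentially. ?P n (u 0) x < u t x + v / 2"
    "\<forall>\<^sub>F n in sequentially. ?P n (u 0) z < u t z + v / 2"
    "\<forall>\<^sub>F n in sequentially. ?P n (u 0) y > u t y - \<epsilon> * \<eta>"
    by (rule order_tendstoD[OF lim'], use v \<epsilon>(1) \<eta> in simp)+
  then have "\<forall>\<^sub>F n in sequentially. ?P n (u 0) x < u t x + v / 2 \<and> ?P n (u 0) z < u t z + v / 2 \<and>
      ?P n (u 0) y > u t y - \<epsilon> * \<eta> \<and> n \<ge> m \<and>
      (n > 0 \<and> (1 + K) * (t / real n) \<le> 1 / 2 \<and> t / real n \<le> 1)"
    by (intro eventually_conj eventually_small eventually_ge_at_top)
  then obtain n where n: "?P n (u 0) x < u t x + v / 2" "?P n (u 0) z < u t z + v / 2"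
      "?P n (u 0) y > u t y - \<epsilon> * \<eta>" "n \<ge> m"
      "n > 0" "(1 + K) * (t / real n) \<le> 1 / 2" "t / real n \<le> 1"
    using eventually_happens'[OF sequentially_bot] by blast
  have t0: "0 \<le> t" using t by simp
  have dn: "\<bar>d n k y - (1 - t / n)\<bar> \<le> K * (t / n)" if "k < n" for k y
    using d[of n k y] n that by simp
  have d0: "d n k y > 0" if "k < n" for k y
    using multiplier_ge[OF dn[OF that, of y]] n by linarith
  define f where "f = (\<lambda>y. 1 * u 0 y + \<epsilon> * ?\<delta> y)"
  have Pf: "?P n f w = ?P n (u 0) w + \<epsilon> * ?P n ?\<delta> w" for w
    unfolding f_def scheme_linear by simp
  have le: "\<epsilon> * ?P n ?\<delta> w \<le> v / 2" for w
  proof -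
    have "?P n ?\<delta> w \<le> C" unfolding C_def using t0 n(5,7) dn by (rule scheme_point_mass_le)
    then have "\<epsilon> * ?P n ?\<delta> w \<le> \<epsilon> * C" using \<epsilon>(1) by (intro mult_left_mono) auto
    then show ?thesis using \<epsilon>(2) by simp
  qed
  have fx: "?P n f x < 0" using n(1) le[of x] unfolding Pf v_def by linarith
  have fz: "?P n f z < 0" using n(2) le[of z] unfolding Pf v_def by linarith
  have "\<eta> \<le> ?P n ?\<delta> y"
    unfolding \<eta>_def using t0 n(5,6,7) dn m_def n(4) by (rule scheme_point_mass_ge)
  then have "\<epsilon> * \<eta> \<le> \<epsilon> * ?P n ?\<delta> y" using \<epsilon> by (intro mult_left_mono) auto
  then have fy: "?P n f y > 0" using n(3) y unfolding Pf by linarith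
  have "alternates (?P n f) 2"
    unfolding alternates_def
  proof (intro exI[of _ "\<lambda>i. if i = 1 then x else if i = 2 then y else z"] ballI)
    fix i :: nat assume "i \<in> {1..2}"
    then have "i = 1 \<or> i = 2" by auto
    then show "(if i = 1 then x else if i = 2 then y else z)
          < (if i + 1 = 1 then x else if i + 1 = 2 then y else z) \<and>
        ?P n f (if i = 1 then x else if i = 2 then y else z) *
          ?P n f (if i + 1 = 1 then x else if i + 1 = 2 then y else z) < 0"
      using x(1) yz fx fy fz by (auto simp: mult_less_0_iff)
  qed
  moreover have "t / real n / 2 \<ge> 0" using t by simp
  ultimately have "alternates f 2" using alternates_scheme[of "t / real n / 2" n "d n" f 2] d0 by blast
  then obtain p :: "nat \<Rightarrow> int" where p: "\<And>i. i \<in> {1..2} \<Longrightarrow> p i < p (i + 1) \<and> f (p i) * f (p (i + 1)) < 0"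
    unfolding alternates_def by blast
  have p12: "p 1 < p 2" "f (p 1) * f (p 2) < 0" using p[of 1] by (auto simp: numeral_2_eq_2)
  have p23: "p 2 < p 3" "f (p 2) * f (p 3) < 0" using p[of 2] by (auto simp: numeral_3_eq_3 numeral_2_eq_2)
  \<comment> \<open>The mass sits at \<open>b\<close>, where the datum is already positive, so the
    set of positivity is unchanged.\<close>
  have fpos: "f w > 0 \<longleftrightarrow> b \<le> w" for w
    using pos[of w] pos[of b] \<epsilon>(1) by (cases "w = b") (auto simp: f_def add_pos_pos)
  \<comment> \<open>Positivity of \<open>f\<close> persists to the right, so after the first sign
    change there cannot be another.\<close>
  have "f (p 2) > 0 \<or> f (p 1) > 0" using p12(2) by (auto simp: mult_less_0_iff)
  then have "f (p 2) > 0" using p12(1) unfolding fpos by auto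
  moreover from this have "f (p 3) > 0" using p23(1) unfolding fpos by auto
  ultimately show False using p23(2) by (simp add: mult_less_0_iff)
qed

text \<open>Changing the sign of both space and solution exchanges the negative left end with the
  positive right end, so each one-sided result has a mirror image.\<close>

lemma reflect: "lattice_heat_flow T K L M (\<lambda>t y. - u t (- y))"
proof
  fix s t :: real and y :: int assume st: "0 \<le> s" "s \<le> t" "t \<le> T"
  have "discrete_laplace (\<lambda>y. - u s (- y)) y = - discrete_laplace (u s) (- y)"
  proof -
    have "- (y + 1) = - y - 1" "- (y - 1) = - y + 1" by auto
    then show ?thesis unfolding discrete_laplace_def by simp
  qed
  then have "- u t (- y) - - u s (- y) - (t - s) / 2 * discrete_laplace (\<lambda>y. - u s (- y)) y =
      - (u t (- y) - u s (- y) - (t - s) / 2 * discrete_laplace (u s) (- y))"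
    by simp
  then show "\<bar>- u t (- y) - - u s (- y) - (t - s) / 2 * discrete_laplace (\<lambda>y. - u s (- y)) y\<bar>
      \<le> K * (t - s) * \<bar>- u s (- y)\<bar> + L * (t - s)\<^sup>2"
    using euler[OF st, of "- y"] by simp
qed (use K_nonneg L_nonneg M_nonneg u_bound in auto)

text \<open>The set is closed downwards, nonempty, and bounded above because the reflected flow
  provides a point of positivity; so it has a largest element.\<close>

lemma negative_set:
  assumes t: "0 < t" "t \<le> T" and pos: "\<And>y. u 0 y > 0 \<longleftrightarrow> b \<le> y" and neg: "\<And>y. u 0 y < 0 \<longleftrightarrow> y \<le> a"
    and ab: "a < b"
  obtains a' where "{y. u t y < 0} = {y. y \<le> a'}"
proof -
  interpret refl: lattice_heat_flow T K L M "\<lambda>t y. - u t (- y)" by (rule reflect)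
  obtain y1 where "- u t (- y1) < 0"
    using refl.negative_far_left[OF t, of "- a" "- b" 0] pos neg ab by auto
  then have y1: "u t (- y1) > 0" by simp
  have down: "u t y < 0" if "u t z < 0" "y < z" for y z
    using negative_down_closed[OF t pos neg ab that] .
  have bdd: "y < - y1" if "u t y < 0" for y
    using down[OF that, of "- y1"] y1 that by (metis linorder_neqE not_less_iff_gr_or_eq)
  obtain x where x: "u t x < 0"
    using negative_far_left[OF t, of b a 0] pos neg ab by auto
  \<comment> \<open>Cutting off below at a known negative point makes the set finite, so that
    \<open>Max\<close> is available.\<close>
  define A where "A = {y. u t y < 0} \<inter> {x..}"
  have "A \<subseteq> {x..- y1}" using bdd by (force simp: A_def)
  then have fin: "finite A" by (rule finite_subset) simp
  have ne: "x \<in> A" using x by (simp add: A_def)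
  have "Max A \<in> A" using fin ne by (intro Max_in) auto
  then have Max: "u t (Max A) < 0" "x \<le> Max A" by (auto simp: A_def)
  have "u t y < 0 \<longleftrightarrow> y \<le> Max A" for y
  proof
    assume "u t y < 0"
    then show "y \<le> Max A"
      using fin Max(2) by (cases "x \<le> y") (auto simp: A_def)
  next
    assume "y \<le> Max A"
    then show "u t y < 0" using down[OF Max(1), of y] Max(1) by (cases "y = Max A") auto
  qed
  then show thesis by (intro that[of "Max A"]) auto
qed

lemma single_crossing:
  assumes t: "0 < t" "t \<le> T" and pos: "\<And>y. u 0 y > 0 \<longleftrightarrow> b \<le> y" and neg: "\<And>y. u 0 y < 0 \<longleftrightarrow> y \<le> a"
    and ab: "a < b"
  obtains a' b' where "a' < b'" "{y. u t y < 0} = {y. y \<le> a'}" "{y. u t y > 0} = {y. b' \<le> y}"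
proof -
  interpret refl: lattice_heat_flow T K L M "\<lambda>t y. - u t (- y)" by (rule reflect)
  obtain a' where a': "{y. u t y < 0} = {y. y \<le> a'}" using negative_set[OF t pos neg ab] .
  have "- u 0 (- y) > 0 \<longleftrightarrow> - a \<le> y" "- u 0 (- y) < 0 \<longleftrightarrow> y \<le> - b" for y
    using pos[of "- y"] neg[of "- y"] by auto
  then obtain c where c: "{y. - u t (- y) < 0} = {y. y \<le> c}"
    using refl.negative_set[OF t, of "- a" "- b"] ab by auto
  have pos_t: "u t y > 0 \<longleftrightarrow> - c \<le> y" for y using c[unfolded set_eq_iff mem_Collect_eq, rule_format, of "- y"] by auto
  have "a' < - c"
  proof (rule ccontr)
    assume "\<not> a' < - c"
    then have "u t a' > 0" using pos_t by simp
    moreover have "u t a' < 0" using a'[unfolded set_eq_iff mem_Collect_eq, rule_format, of a'] by simp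
    ultimately show False by simp
  qed
  then show thesis using that[of a' "- c"] a' pos_t by auto
qed

end

theorem theorem3p1:
  fixes \<kappa> :: "real \<Rightarrow> int \<Rightarrow> real" and u\<^sub>0 :: "int \<Rightarrow> real" and u :: "real \<Rightarrow> int \<Rightarrow> real"
  assumes "L_infinity \<kappa>"
    and "(\<lambda>y. \<bar>u\<^sub>0 y\<bar>) summable_on UNIV"
    and "is_solution \<kappa> u\<^sub>0 u"
  shows "(\<forall>s t. 0 \<le> s \<and> s \<le> t \<longrightarrow> zero_crossings (u t) \<le> zero_crossings (u s)) \<and>
    (zero_crossings u\<^sub>0 = 1 \<longrightarrow>
      (\<exists>a\<^sub>0 b\<^sub>0 :: int. a\<^sub>0 < b\<^sub>0 \<and> {y. u\<^sub>0 y < 0} = {y. y \<le> a\<^sub>0} \<and> {y. u\<^sub>0 y > 0} = {y. y \<ge> b\<^sub>0}) \<longrightarrow>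
      (\<forall>t\<ge>0. \<exists>a b :: int extended. a < b \<and>
         {y. u t y < 0} = {y. Fin y \<le> a} \<and> {y. u t y > 0} = {y. Fin y \<ge> b}))"
proof (intro conjI allI impI)
  fix s t :: real assume st: "0 \<le> s \<and> s \<le> t"
  \<comment> \<open>The horizon \<open>t + 1\<close> is positive even for
    \<open>t = 0\<close>.\<close>
  have "t + 1 > 0" using st by simp
  then obtain K L M where "lattice_heat_flow (t + 1) K L M u"
    using is_solution_lattice_heat_flow[OF assms(1,3)] by blast
  then interpret lattice_heat_flow "t + 1" K L M u .
  show "zero_crossings (u t) \<le> zero_crossings (u s)"
    using alternates_decreasing[of s t] st by (intro zero_crossings_mono) simp
next
  fix t :: real
  assume "\<exists>a\<^sub>0 b\<^sub>0 :: int. a\<^sub>0 < b\<^sub>0 \<and> {y. u\<^sub>0 y < 0} = {y. y \<le> a\<^sub>0} \<and> {y. u\<^sub>0 y > 0} = {y. y \<ge> b\<^sub>0}"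
  then obtain a b :: int where ab: "a < b" "{y. u\<^sub>0 y < 0} = {y. y \<le> a}" "{y. u\<^sub>0 y > 0} = {y. b \<le> y}"
    by blast
  have u0: "u 0 = u\<^sub>0" using assms(3) by (auto simp: is_solution_def)
  have neg: "u 0 y < 0 \<longleftrightarrow> y \<le> a" and pos: "u 0 y > 0 \<longleftrightarrow> b \<le> y" for y
    using ab(2,3) by (auto simp: u0 set_eq_iff)
  assume "t \<ge> 0"
  \<comment> \<open>The solution takes both signs at every time, so the endpoints are found among
    the integers and then embedded by \<open>Fin\<close>.\<close>
  have "\<exists>a b :: int. a < b \<and> {y. u t y < 0} = {y. y \<le> a} \<and> {y. u t y > 0} = {y. b \<le> y}"
  proof (cases "t = 0")
    case True
    then show ?thesis using ab u0 by auto
  next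
    case False
    then have t: "0 < t" using \<open>t \<ge> 0\<close> by simp
    obtain K L M where "lattice_heat_flow t K L M u"
      using is_solution_lattice_heat_flow[OF assms(1,3) t] .
    then interpret lattice_heat_flow t K L M u .
    show ?thesis using single_crossing[OF t order_refl pos neg ab(1)] by metis
  qed
  then obtain a' b' :: int where "a' < b'" "{y. u t y < 0} = {y. y \<le> a'}" "{y. u t y > 0} = {y. b' \<le> y}"
    by blast
  then show "\<exists>a b :: int extended. a < b \<and>
         {y. u t y < 0} = {y. Fin y \<le> a} \<and> {y. u t y > 0} = {y. Fin y \<ge> b}"
    by (intro exI[of _ "Fin a'"] exI[of _ "Fin b'"]) simp
qed

end
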